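(* $Q^*$ is uniquely identified (on $\bar{\mathcal S}\times\mathcal A$) as the minimizer in $Q$ of $$\min_{Q\in\mathcal Q}\mathcal R_{\exp}(Q)=\min_{Q\in\mathcal Q}\mathbb E_{(s,a)\sim d^*}\Bigl[-\log\hat p_Q(a\mid s)+\mathbf 1_{a=a_s}\bigl\{\mathbb E_{s'\sim P(s,a)}[(\hat{\mathcal T}Q(s,a,s')-Q(s,a))^2]-\beta^2D(Q)(s,a)\bigr\}\Bigr]$$ $$=\min_{Q\in\mathcal Q}\max_{\zeta\in\mathbb R^{\mathcal S\times\mathcal A}}\mathbb E_{(s,a)\sim d^*,\,s'\sim P(s,a)}\Bigl[-\log\hat p_Q(a\mid s)+\mathbf 1_{a=a_s}\bigl\{(\hat{\mathcal T}Q(s,a,s')-Q(s,a))^2-\beta^2(V_Q(s')-\zeta(s,a))^2\bigr\}\Bigr],$$ that is, both displayed equalities hold and any minimizing $Q$ agrees with $Q^*$ on $\bar{\mathcal S}\times\mathcal A$. Furthermore, $r(s,a)=Q^*(s,a)-\beta\,\zeta^*(s,a)$, where $\zeta^*(s,a)=\arg\min_{\zeta\in\mathbb R}\mathbb E_{s'\sim P(s,a)}[(V_{Q^*}(s')-\zeta)^2\mid s,a]$.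
   Context: Setting. $(\mathcal S,\mathcal A,P,\nu_0,r,\beta)$ is a Markov decision process with state space $\mathcal S$, finite action space $\mathcal A$, transition kernel $P(s,a)$, initial state distribution $\nu_0$, reward $r:\mathcal S\times\mathcal A\to\mathbb R$, discount factor $\beta\in(0,1)$. $\mathcal Q=\{Q:\mathcal S\times\mathcal A\to\mathbb R:\|Q\|_\infty<\infty\}$. For $Q\in\mathcal Q$: $V_Q(s)=\log\sum_{a}\exp Q(s,a)$; $\hat p_Q(a\mid s)=\exp(Q(s,a))/\sum_{b}\exp(Q(s,b))$; $\mathcal TQ(s,a)=r(s,a)+\beta\,\mathbb E_{s'\sim P(s,a)}[V_Q(s')]$; $\hat{\mathcal T}Q(s,a,s')=r(s,a)+\beta V_Q(s')$; $D(Q)(s,a)=\min_{\zeta\in\mathbb R}\mathbb E_{s'\sim P(s,a)}[(V_Q(s')-\zeta)^2\mid s,a]$. $Q^*\in\mathcal Q$ is the unique solution of $\mathcal TQ^*=Q^*$; the data-generating agent follows the entropy-regularized optimal policy $\pi^*=\hat p_{Q^*}$. $d^*=(1-\beta)\sum_{t\ge0}\beta^t\,\mathbb P_{\nu_0,\pi^*}\{(s_t,a_t)\in\cdot\}$ is the expert state-action distribution and $\bar{\mathcal S}=\{s:\mathbb P_{\nu_0,\pi^*}(s_h=s)>0\text{ for some }h\ge0\}$. For each $s$ there is a given anchor action $a_s\in\mathcal A$ with $r(s,a_s)$ known. The expected risk is $$\mathcal R_{\exp}(Q)=\mathbb E_{(s,a)\sim d^*}\bigl[-\log \hat p_Q(a\mid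 s)+\mathbf 1_{a=a_s}(\mathcal TQ(s,a)-Q(s,a))^2\bigr].$$ *)

theory Defs
  imports "HOL-Probability.Probability"
begin

text \<open>
  The state space is a measurable space \<open>S\<close> on the whole type \<^typ>\<open>'s\<close>; the countable or discrete
  case is \<open>sets S = UNIV\<close>, where every measurability requirement below is vacuous.
  The action space is a finite type \<^typ>\<open>'a\<close>.
\<close>

definition Q_space :: "'s measure \<Rightarrow> ('s \<Rightarrow> 'a \<Rightarrow> real) set" where
  "Q_space S = {Q. (\<forall>a. (\<lambda>s. Q s a) \<in> borel_measurable S) \<and> bounded (range (\<lambda>(s, a). Q s a))}"

definition zeta_space :: "'s measure \<Rightarrow> ('s \<Rightarrow> 'a \<Rightarrow> real) set" where
  "zeta_space S = {\<zeta>. \<forall>a. (\<lambda>s. \<zeta> s a) \<in> borel_measurable S}"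

definition soft_value :: "('s \<Rightarrow> 'a::finite \<Rightarrow> real) \<Rightarrow> 's \<Rightarrow> real" where
  "soft_value Q s = ln (\<Sum>a\<in>UNIV. exp (Q s a))"

definition choice_prob :: "('s \<Rightarrow> 'a::finite \<Rightarrow> real) \<Rightarrow> 's \<Rightarrow> 'a \<Rightarrow> real" where
  "choice_prob Q s a = exp (Q s a) / (\<Sum>b\<in>UNIV. exp (Q s b))"

definition bellman ::
    "('s \<Rightarrow> 'a \<Rightarrow> 's measure) \<Rightarrow> ('s \<Rightarrow> 'a \<Rightarrow> real) \<Rightarrow> real \<Rightarrow>
     ('s \<Rightarrow> 'a::finite \<Rightarrow> real) \<Rightarrow> 's \<Rightarrow> 'a \<Rightarrow> real" where
  "bellman P r \<beta> Q s a = r s a + \<beta> * (\<integral>s'. soft_value Q s' \<partial>P s a)"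

definition sampled_bellman ::
    "('s \<Rightarrow> 'a \<Rightarrow> real) \<Rightarrow> real \<Rightarrow> ('s \<Rightarrow> 'a::finite \<Rightarrow> real) \<Rightarrow> 's \<Rightarrow> 'a \<Rightarrow> 's \<Rightarrow> real" where
  "sampled_bellman r \<beta> Q s a s' = r s a + \<beta> * soft_value Q s'"

definition value_sq_dev ::
    "('s \<Rightarrow> 'a \<Rightarrow> 's measure) \<Rightarrow> ('s \<Rightarrow> 'a::finite \<Rightarrow> real) \<Rightarrow> 's \<Rightarrow> 'a \<Rightarrow> real \<Rightarrow> real" where
  "value_sq_dev P Q s a z = (\<integral>s'. (soft_value Q s' - z)\<^sup>2 \<partial>P s a)"

definition D_term ::
    "('s \<Rightarrow> 'a \<Rightarrow> 's measure) \<Rightarrow> ('s \<Rightarrow> 'a::finite \<Rightarrow> real) \<Rightarrow> 's \<Rightarrow> 'a \<Rightarrow> real" where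
  "D_term P Q s a = (\<Sqinter>z. value_sq_dev P Q s a z)"

definition is_unique_fixed_point ::
    "'s measure \<Rightarrow> ('s \<Rightarrow> 'a \<Rightarrow> 's measure) \<Rightarrow> ('s \<Rightarrow> 'a \<Rightarrow> real) \<Rightarrow> real \<Rightarrow>
     ('s \<Rightarrow> 'a::finite \<Rightarrow> real) \<Rightarrow> bool" where
  "is_unique_fixed_point S P r \<beta> Q \<longleftrightarrow>
     Q \<in> Q_space S \<and> bellman P r \<beta> Q = Q \<and>
     (\<forall>Q'\<in>Q_space S. bellman P r \<beta> Q' = Q' \<longrightarrow> Q' = Q)"

text \<open>
  The law of the trajectory \<open>(s\<^sub>0, a\<^sub>0), (s\<^sub>1, a\<^sub>1), \<dots>\<close> is the Ionescu-Tulcea measure for the kernels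
  that draw \<open>s\<^sub>0\<close> from \<open>\<nu>\<^sub>0\<close>, then \<open>s\<^sub>t\<close> from \<open>P s\<^sub>t\<^sub>-\<^sub>1 a\<^sub>t\<^sub>-\<^sub>1\<close>, and \<open>a\<^sub>t\<close> from \<open>\<pi> s\<^sub>t\<close>.
\<close>

definition kernel_prod ::
    "'x measure \<Rightarrow> 'y measure \<Rightarrow> ('x \<Rightarrow> 'y measure) \<Rightarrow> ('x \<times> 'y) measure" where
  "kernel_prod M N K = M \<bind> (\<lambda>x. K x \<bind> (\<lambda>y. return (M \<Otimes>\<^sub>M N) (x, y)))"

abbreviation sa_space :: "'s measure \<Rightarrow> ('s \<times> 'a) measure" where
  "sa_space S \<equiv> S \<Otimes>\<^sub>M count_space UNIV"

definition state_action ::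
    "('s \<Rightarrow> 'a::finite \<Rightarrow> real) \<Rightarrow> 's measure \<Rightarrow> ('s \<times> 'a) measure" where
  "state_action \<pi> \<mu> =
     kernel_prod \<mu> (count_space UNIV) (\<lambda>s. point_measure UNIV (\<lambda>a. ennreal (\<pi> s a)))"

definition step_kernel ::
    "('s \<Rightarrow> 'a \<Rightarrow> 's measure) \<Rightarrow> 's measure \<Rightarrow> ('s \<Rightarrow> 'a::finite \<Rightarrow> real) \<Rightarrow>
     nat \<Rightarrow> (nat \<Rightarrow> 's \<times> 'a) \<Rightarrow> ('s \<times> 'a) measure" where
  "step_kernel P \<nu>\<^sub>0 \<pi> t \<omega> =
     state_action \<pi> (case t of 0 \<Rightarrow> \<nu>\<^sub>0 | Suc i \<Rightarrow> P (fst (\<omega> i)) (snd (\<omega> i)))"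

definition trajectory ::
    "'s measure \<Rightarrow> ('s \<Rightarrow> 'a \<Rightarrow> 's measure) \<Rightarrow> 's measure \<Rightarrow> ('s \<Rightarrow> 'a::finite \<Rightarrow> real) \<Rightarrow>
     (nat \<Rightarrow> 's \<times> 'a) measure" where
  "trajectory S P \<nu>\<^sub>0 \<pi> =
     projective_family.lim UNIV
       (Ionescu_Tulcea.CI (step_kernel P \<nu>\<^sub>0 \<pi>) (\<lambda>_. sa_space S)) (\<lambda>_. sa_space S)"

definition occupancy ::
    "'s measure \<Rightarrow> ('s \<Rightarrow> 'a \<Rightarrow> 's measure) \<Rightarrow> 's measure \<Rightarrow> real \<Rightarrow> ('s \<Rightarrow> 'a::finite \<Rightarrow> real) \<Rightarrow>
     ('s \<times> 'a) measure" where
  "occupancy S P \<nu>\<^sub>0 \<beta> \<pi> =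
     measure_of UNIV (sets (sa_space S))
       (\<lambda>X. ennreal (1 - \<beta>) *
          (\<Sum>t. ennreal (\<beta> ^ t) * emeasure (trajectory S P \<nu>\<^sub>0 \<pi>) {\<omega> \<in> space (trajectory S P \<nu>\<^sub>0 \<pi>). \<omega> t \<in> X}))"

definition reachable_states ::
    "'s measure \<Rightarrow> ('s \<Rightarrow> 'a \<Rightarrow> 's measure) \<Rightarrow> 's measure \<Rightarrow> ('s \<Rightarrow> 'a::finite \<Rightarrow> real) \<Rightarrow> 's set" where
  "reachable_states S P \<nu>\<^sub>0 \<pi> =
     {s. \<exists>h. measure (trajectory S P \<nu>\<^sub>0 \<pi>) {\<omega> \<in> space (trajectory S P \<nu>\<^sub>0 \<pi>). fst (\<omega> h) = s} > 0}"

definition expected_risk ::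
    "('s \<Rightarrow> 'a \<Rightarrow> 's measure) \<Rightarrow> ('s \<Rightarrow> 'a \<Rightarrow> real) \<Rightarrow> real \<Rightarrow> ('s \<Rightarrow> 'a) \<Rightarrow> ('s \<times> 'a) measure \<Rightarrow>
     ('s \<Rightarrow> 'a::finite \<Rightarrow> real) \<Rightarrow> real" where
  "expected_risk P r \<beta> anchor d Q =
     (\<integral>(s, a). - ln (choice_prob Q s a) +
        of_bool (a = anchor s) * (bellman P r \<beta> Q s a - Q s a)\<^sup>2 \<partial>d)"

definition corrected_risk ::
    "('s \<Rightarrow> 'a \<Rightarrow> 's measure) \<Rightarrow> ('s \<Rightarrow> 'a \<Rightarrow> real) \<Rightarrow> real \<Rightarrow> ('s \<Rightarrow> 'a) \<Rightarrow> ('s \<times> 'a) measure \<Rightarrow>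
     ('s \<Rightarrow> 'a::finite \<Rightarrow> real) \<Rightarrow> real" where
  "corrected_risk P r \<beta> anchor d Q =
     (\<integral>(s, a). - ln (choice_prob Q s a) +
        of_bool (a = anchor s) *
          ((\<integral>s'. (sampled_bellman r \<beta> Q s a s' - Q s a)\<^sup>2 \<partial>P s a) - \<beta>\<^sup>2 * D_term P Q s a) \<partial>d)"

text \<open>
  An unbounded \<open>\<zeta>\<close> can make the min-max integrand non-integrable, with expectation \<open>-\<infinity>\<close>.
  The Bochner integral would return the default value \<open>0\<close> there, so the expectation is
  taken in the extended reals.
\<close>

definition ereal_expectation :: "'x measure \<Rightarrow> ('x \<Rightarrow> real) \<Rightarrow> ereal" where
  "ereal_expectation M f =
     enn2ereal (\<integral>\<^sup>+x. ennreal (f x) \<partial>M) - enn2ereal (\<integral>\<^sup>+x. ennreal (- f x) \<partial>M)"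

definition minimax_objective ::
    "'s measure \<Rightarrow> ('s \<Rightarrow> 'a \<Rightarrow> 's measure) \<Rightarrow> ('s \<Rightarrow> 'a \<Rightarrow> real) \<Rightarrow> real \<Rightarrow> ('s \<Rightarrow> 'a) \<Rightarrow>
     ('s \<times> 'a) measure \<Rightarrow> ('s \<Rightarrow> 'a::finite \<Rightarrow> real) \<Rightarrow> ('s \<Rightarrow> 'a \<Rightarrow> real) \<Rightarrow> ereal" where
  "minimax_objective S P r \<beta> anchor d Q \<zeta> =
     ereal_expectation (kernel_prod d S (\<lambda>(s, a). P s a))
       (\<lambda>((s, a), s'). - ln (choice_prob Q s a) +
          of_bool (a = anchor s) *
            ((sampled_bellman r \<beta> Q s a s' - Q s a)\<^sup>2 - \<beta>\<^sup>2 * (soft_value Q s' - \<zeta> s a)\<^sup>2))"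

end

theory Submission
  imports Defs
begin

text \<open>
  Let \<open>u\<close> be the log likelihood ratio of \<open>choice_prob Q\<close> to \<open>choice_prob Qstar\<close>. The occupancy
  measure is invariant under resampling the action from \<open>choice_prob Qstar\<close>, so \<open>exp u\<close> has
  mean \<open>1\<close> and the risk of \<open>Q\<close> exceeds that of \<open>Qstar\<close> by the mean of a nonnegative function. If
  this excess vanishes, then almost everywhere \<open>Q = Qstar + c\<close> for a bounded function \<open>c\<close> of
  the state with \<open>c s = \<beta> * (\<integral>s'. c s' \<partial>P s (anchor s))\<close>; since the support of the occupancy
  measure is closed under transitions, an almost sure bound on \<open>c\<close> improves by the factor \<open>\<beta>\<close>,
  so that \<open>c = 0\<close>. The other two objectives reduce to the risk by the bias-variance decomposition,
  the optimal \<open>\<zeta>\<close> being the conditional mean of the soft value.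
\<close>

section \<open>Kernels and the occupancy measure\<close>

lemma measurable_pair_count_space:
  fixes f :: "'s \<times> 'a::finite \<Rightarrow> 'b"
  assumes "\<And>a. (\<lambda>s. f (s, a)) \<in> M \<rightarrow>\<^sub>M N"
  shows "f \<in> M \<Otimes>\<^sub>M count_space UNIV \<rightarrow>\<^sub>M N"
proof -
  have "(\<lambda>x. f (fst x, snd x)) \<in> M \<Otimes>\<^sub>M count_space UNIV \<rightarrow>\<^sub>M N"
    using assms
    by (intro measurable_compose_countable[where f="\<lambda>a x. f (fst x, a)" and g=snd]
          measurable_compose[OF measurable_fst]) simp_all
  then show ?thesis by simp
qed

text \<open>The target algebra in \<open>kernel_prod\<close> mentions the measure \<open>M\<close>
  itself. Replacing it by a fixed space \<open>M'\<close> makes the function under the bind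
  independent of \<open>M\<close>, so that measurability in \<open>M\<close> can be stated.\<close>

lemma kernel_prod_eq:
  assumes "sets M = sets M'"
  shows "kernel_prod M N K = M \<bind> (\<lambda>x. K x \<bind> (\<lambda>y. return (M' \<Otimes>\<^sub>M N) (x, y)))"
proof -
  have "sets (M \<Otimes>\<^sub>M N) = sets (M' \<Otimes>\<^sub>M N)"
    using assms by (rule sets_pair_measure_cong) simp
  then have "return (M \<Otimes>\<^sub>M N) = return (M' \<Otimes>\<^sub>M N)"
    by (intro ext return_cong)
  then show ?thesis
    unfolding kernel_prod_def by simp
qed

lemma measurable_bind_return_pair:
  assumes K: "K \<in> M \<rightarrow>\<^sub>M prob_algebra N"
  shows "(\<lambda>x. K x \<bind> (\<lambda>y. return (M \<Otimes>\<^sub>M N) (x, y))) \<in> M \<rightarrow>\<^sub>M prob_algebra (M \<Otimes>\<^sub>M N)"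
  by (rule measurable_bind_prob_space2[OF K]) (simp add: measurable_return_prob_space)

lemma kernel_prod_in_prob_algebra:
  assumes M: "M \<in> space (prob_algebra M')" and K: "K \<in> M' \<rightarrow>\<^sub>M prob_algebra N"
  shows "kernel_prod M N K \<in> space (prob_algebra (M' \<Otimes>\<^sub>M N))"
proof -
  have sets: "sets M = sets M'"
    using M by (simp add: space_prob_algebra)
  show ?thesis
    unfolding kernel_prod_eq[OF sets]
    using prob_space_bind'[OF M measurable_bind_return_pair[OF K]]
      sets_bind'[OF M measurable_bind_return_pair[OF K]]
    by (simp add: space_prob_algebra)
qed

text \<open>Tonelli for the two nested binds: the outer one integrates over \<open>M\<close>, the
  inner one over \<open>K x\<close>, and the \<open>return\<close> evaluates \<open>f\<close> at the
  pair.\<close>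

lemma nn_integral_kernel_prod:
  assumes sets: "sets M = sets M'" and K: "K \<in> M' \<rightarrow>\<^sub>M prob_algebra N"
    and f: "f \<in> borel_measurable (M' \<Otimes>\<^sub>M N)"
  shows "(\<integral>\<^sup>+z. f z \<partial>kernel_prod M N K) = (\<integral>\<^sup>+x. \<integral>\<^sup>+y. f (x, y) \<partial>K x \<partial>M)"
proof -
  have sp: "space M = space M'" using sets by (rule sets_eq_imp_space_eq)
  have inner: "(\<integral>\<^sup>+z. f z \<partial>(K x \<bind> (\<lambda>y. return (M' \<Otimes>\<^sub>M N) (x, y)))) = (\<integral>\<^sup>+y. f (x, y) \<partial>K x)"
    if x: "x \<in> space M'" for x
  proof -
    have Kx: "sets (K x) = sets N"
      using measurable_space[OF K x] by (simp add: space_prob_algebra)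
    then have spx: "space (K x) = space N" by (rule sets_eq_imp_space_eq)
    have "(\<lambda>y. return (M' \<Otimes>\<^sub>M N) (x, y)) \<in> N \<rightarrow>\<^sub>M subprob_algebra (M' \<Otimes>\<^sub>M N)"
      using x by measurable
    then have "(\<lambda>y. return (M' \<Otimes>\<^sub>M N) (x, y)) \<in> K x \<rightarrow>\<^sub>M subprob_algebra (M' \<Otimes>\<^sub>M N)"
      using Kx measurable_cong_sets by blast
    from nn_integral_bind[OF f this] show ?thesis
      using x spx f by (auto simp: space_pair_measure nn_integral_return intro!: nn_integral_cong)
  qed
  have "(\<lambda>x. K x \<bind> (\<lambda>y. return (M' \<Otimes>\<^sub>M N) (x, y))) \<in> M \<rightarrow>\<^sub>M subprob_algebra (M' \<Otimes>\<^sub>M N)"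
    using measurable_prob_algebraD[OF measurable_bind_return_pair[OF K]] sets measurable_cong_sets
    by blast
  from nn_integral_bind[OF f this] show ?thesis
    unfolding kernel_prod_eq[OF sets] using inner sp by (auto intro!: nn_integral_cong)
qed

lemma measurable_point_measure:
  fixes \<pi> :: "'s \<Rightarrow> 'a::finite \<Rightarrow> real"
  assumes meas: "\<And>a. (\<lambda>s. \<pi> s a) \<in> borel_measurable S"
    and nonneg: "\<And>s a. 0 \<le> \<pi> s a" and sum: "\<And>s. (\<Sum>a\<in>UNIV. \<pi> s a) = 1"
  shows "(\<lambda>s. point_measure UNIV (\<lambda>a. ennreal (\<pi> s a))) \<in> S \<rightarrow>\<^sub>M prob_algebra (count_space UNIV)"
proof (rule measurable_prob_algebraI)
  show prob: "prob_space (point_measure UNIV (\<lambda>a. ennreal (\<pi> s a)))" for s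
    by (rule prob_spaceI)
      (simp add: space_point_measure emeasure_point_measure_finite sum_ennreal nonneg sum)
  show "(\<lambda>s. point_measure UNIV (\<lambda>a. ennreal (\<pi> s a))) \<in> S \<rightarrow>\<^sub>M subprob_algebra (count_space UNIV)"
    using meas
    by (intro measurable_subprob_algebra)
      (auto simp: prob[THEN prob_space_imp_subprob_space] sets_point_measure emeasure_point_measure_finite)
qed

section \<open>Stochastic policies and resampling of the action\<close>

locale stochastic_policy =
  fixes S :: "'s measure" and \<pi> :: "'s \<Rightarrow> 'a::finite \<Rightarrow> real"
  assumes policy_measurable [measurable]: "\<And>a. (\<lambda>s. \<pi> s a) \<in> borel_measurable S"
    and policy_nonneg: "\<And>s a. 0 \<le> \<pi> s a"
    and policy_sum: "\<And>s. (\<Sum>a\<in>UNIV. \<pi> s a) = 1"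
begin

lemmas policy_kernel = measurable_point_measure[OF policy_measurable policy_nonneg policy_sum]

lemma nn_integral_state_action:
  assumes "sets \<mu> = sets S" and "f \<in> borel_measurable (sa_space S)"
  shows "(\<integral>\<^sup>+x. f x \<partial>state_action \<pi> \<mu>) = (\<integral>\<^sup>+s. (\<Sum>a\<in>UNIV. ennreal (\<pi> s a) * f (s, a)) \<partial>\<mu>)"
  unfolding state_action_def
  by (simp add: nn_integral_kernel_prod[OF assms(1) policy_kernel assms(2)]
      nn_integral_point_measure_finite)

lemma measurable_state_action:
  "state_action \<pi> \<in> prob_algebra S \<rightarrow>\<^sub>M prob_algebra (sa_space S)"
proof -
  have "(\<lambda>\<mu>. \<mu> \<bind> (\<lambda>s. point_measure UNIV (\<lambda>a. ennreal (\<pi> s a)) \<bind> (\<lambda>a. return (sa_space S) (s, a))))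
      \<in> prob_algebra S \<rightarrow>\<^sub>M prob_algebra (sa_space S)"
    by (rule measurable_bind_prob_space[OF _ measurable_bind_return_pair[OF policy_kernel]]) simp
  then show ?thesis
    by (rule measurable_cong[THEN iffD1, rotated])
      (simp add: state_action_def space_prob_algebra kernel_prod_eq[of _ S])
qed

text \<open>The resampled integrand depends on the state alone, so averaging it over the action a
  second time multiplies it by the total mass \<open>1\<close> of the policy.\<close>

lemma state_action_resample:
  assumes "sets \<mu> = sets S" and f: "f \<in> borel_measurable (sa_space S)"
  shows "(\<integral>\<^sup>+x. (\<Sum>b\<in>UNIV. ennreal (\<pi> (fst x) b) * f (fst x, b)) \<partial>state_action \<pi> \<mu>) =
    (\<integral>\<^sup>+x. f x \<partial>state_action \<pi> \<mu>)"
proof -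
  have [measurable]: "f \<in> borel_measurable (sa_space S)" by (fact f)
  have "(\<Sum>a\<in>UNIV. ennreal (\<pi> s a)) = 1" for s
    by (simp add: sum_ennreal policy_nonneg policy_sum)
  then show ?thesis
    by (subst (1 2) nn_integral_state_action[OF assms(1)]) (simp_all add: sum_distrib_right[symmetric])
qed

end

section \<open>The law of the trajectory\<close>

locale controlled_process = stochastic_policy S \<pi>
  for S :: "'s measure" and \<pi> :: "'s \<Rightarrow> 'a::finite \<Rightarrow> real" +
  fixes P :: "'s \<Rightarrow> 'a \<Rightarrow> 's measure" and \<nu>\<^sub>0 :: "'s measure" and \<beta> :: real
  assumes space_S: "space S = UNIV"
    and transition: "\<And>a. (\<lambda>s. P s a) \<in> S \<rightarrow>\<^sub>M prob_algebra S"
    and initial: "\<nu>\<^sub>0 \<in> space (prob_algebra S)"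
    and discount_pos: "0 < \<beta>" and discount_less_1: "\<beta> < 1"
begin

abbreviation "X \<equiv> trajectory S P \<nu>\<^sub>0 \<pi>"
abbreviation "d \<equiv> occupancy S P \<nu>\<^sub>0 \<beta> \<pi>"
abbreviation "K \<equiv> step_kernel P \<nu>\<^sub>0 \<pi>"

lemma transition_pair: "(\<lambda>x. P (fst x) (snd x)) \<in> sa_space S \<rightarrow>\<^sub>M prob_algebra S"
  using transition by (intro measurable_pair_count_space) simp

lemma transition_in: "P s a \<in> space (prob_algebra S)"
  using measurable_space[OF transition] space_S by simp

lemma sets_transition [simp]: "sets (P s a) = sets S"
  using transition_in by (simp add: space_prob_algebra)

lemma prob_space_transition: "prob_space (P s a)"
  using transition_in by (simp add: space_prob_algebra)

lemma measurable_step_kernel: "K t \<in> Pi\<^sub>M {0..<t} (\<lambda>_. sa_space S) \<rightarrow>\<^sub>M prob_algebra (sa_space S)"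
proof -
  have "(\<lambda>\<omega>. case t of 0 \<Rightarrow> \<nu>\<^sub>0 | Suc i \<Rightarrow> P (fst (\<omega> i)) (snd (\<omega> i)))
      \<in> Pi\<^sub>M {0..<t} (\<lambda>_. sa_space S) \<rightarrow>\<^sub>M prob_algebra S"
  proof (cases t)
    case 0
    then show ?thesis using initial by simp
  next
    case (Suc i)
    have "(\<lambda>\<omega>. \<omega> i) \<in> Pi\<^sub>M {0..<t} (\<lambda>_. sa_space S) \<rightarrow>\<^sub>M sa_space S"
      using Suc by (intro measurable_component_singleton) simp
    from measurable_compose[OF this transition_pair] Suc show ?thesis by simp
  qed
  from measurable_compose[OF this measurable_state_action] show ?thesis
    unfolding step_kernel_def[abs_def] .
qed

sublocale IT: Ionescu_Tulcea K "\<lambda>_. sa_space S"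
proof (rule Ionescu_Tulcea.intro)
  show "K i \<in> Pi\<^sub>M {0..<i} (\<lambda>_. sa_space S) \<rightarrow>\<^sub>M subprob_algebra (sa_space S)" for i
    by (rule measurable_prob_algebraD[OF measurable_step_kernel])
  show "prob_space (K i \<omega>)" if "\<omega> \<in> space (Pi\<^sub>M {0..<i} (\<lambda>_. sa_space S))" for i \<omega>
    using measurable_space[OF measurable_step_kernel that] by (simp add: space_prob_algebra)
qed

lemma trajectory_eq: "X = IT.PF.lim"
  by (simp add: trajectory_def)

lemma sets_trajectory [measurable_cong]: "sets X = sets (Pi\<^sub>M UNIV (\<lambda>_. sa_space S))"
  by (simp add: trajectory_eq)

lemma measurable_trajectory [measurable]: "(\<lambda>\<omega>. \<omega> t) \<in> X \<rightarrow>\<^sub>M sa_space S"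
  using measurable_component_singleton[of t UNIV "\<lambda>_. sa_space S"]
  by (simp cong: measurable_cong_sets add: sets_trajectory)

text \<open>Total mass survives the projection onto the empty set of coordinates, and that marginal
  of the projective limit is a probability measure.\<close>

lemma prob_space_trajectory: "prob_space X"
proof -
  have "distr X (Pi\<^sub>M {} (\<lambda>_. sa_space S)) (\<lambda>\<omega>. restrict \<omega> {}) = IT.CI {}"
    unfolding trajectory_eq by (rule IT.distr_lim) simp
  moreover have "prob_space (IT.CI {})"
    by (rule IT.PF.prob_space_P) simp_all
  ultimately have "prob_space (distr X (Pi\<^sub>M {} (\<lambda>_. sa_space S)) (\<lambda>\<omega>. restrict \<omega> {}))" by simp
  then show "prob_space X"
    by (rule prob_space_distrD[rotated]) (intro measurable_restrict, simp)
qed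

text \<open>The least bound \<open>IT.up_to\<close> of the initial segment is \<open>n\<close>
  itself, so \<open>IT.CI\<close> is the composition of the first \<open>n\<close> kernels with no
  coordinate projected away.\<close>

lemma distr_trajectory:
  "distr X (Pi\<^sub>M {0..<n} (\<lambda>_. sa_space S)) (\<lambda>\<omega>. restrict \<omega> {0..<n}) = IT.C 0 n (\<lambda>_. undefined)"
proof -
  have "IT.up_to {0..<n} = n"
    by (rule antisym) (use IT.up_to_iff_Ico[of "{0..<n}"] in auto)
  then show ?thesis
    using IT.distr_C[of n n "\<lambda>_. undefined" 0] IT.distr_lim[of "{0..<n}"]
    unfolding trajectory_eq by (simp add: IT.CI_def)
qed

lemma nn_integral_trajectory_restrict:
  assumes "f \<in> borel_measurable (Pi\<^sub>M {0..<n} (\<lambda>_. sa_space S))"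
  shows "(\<integral>\<^sup>+\<omega>. f \<omega> \<partial>IT.C 0 n (\<lambda>_. undefined)) = (\<integral>\<^sup>+\<omega>. f (restrict \<omega> {0..<n}) \<partial>X)"
  unfolding distr_trajectory[symmetric] using assms
  by (subst nn_integral_distr) (auto intro!: measurable_restrict)

text \<open>The integral moves to the finite composition \<open>IT.C\<close>, whose last kernel is
  peeled off, and then back to the limit. This conditions coordinate \<open>t\<close> on its
  past.\<close>

lemma nn_integral_trajectory:
  assumes f: "f \<in> borel_measurable (sa_space S)"
  shows "(\<integral>\<^sup>+\<omega>. f (\<omega> t) \<partial>X) = (\<integral>\<^sup>+\<omega>. \<integral>\<^sup>+x. f x \<partial>K t \<omega> \<partial>X)"
proof -
  let ?Pi = "\<lambda>n::nat. Pi\<^sub>M {0..<n} (\<lambda>_. sa_space S)"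
  let ?C = "\<lambda>n. IT.C 0 n (\<lambda>_. undefined)"
  have sp: "(\<lambda>_. undefined) \<in> space (?Pi 0)" by simp
  have ft: "(\<lambda>\<omega>. f (\<omega> t)) \<in> borel_measurable (?Pi (Suc t))"
    by (rule measurable_compose[OF _ f]) (rule measurable_component_singleton, simp)
  have g: "(\<lambda>\<omega>. \<integral>\<^sup>+x. f x \<partial>K t \<omega>) \<in> borel_measurable (?Pi t)"
    by (rule measurable_compose[OF IT.P nn_integral_measurable_subprob_algebra[OF f]])
  have sets_C: "sets (?C t) = sets (?Pi t)"
    using IT.sets_C[OF sp, of t] by simp
  have eP: "IT.eP t \<in> ?C t \<rightarrow>\<^sub>M subprob_algebra (?Pi (Suc t))"
    using IT.measurable_eP[of t] measurable_cong_sets[OF sets_C refl] by blast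
  have "(\<integral>\<^sup>+\<omega>. f (\<omega> t) \<partial>X) = (\<integral>\<^sup>+\<omega>. f (\<omega> t) \<partial>?C (Suc t))"
    by (simp add: nn_integral_trajectory_restrict[OF ft] del: IT.C.simps)
  also have "\<dots> = (\<integral>\<^sup>+\<omega>. \<integral>\<^sup>+\<omega>'. f (\<omega>' t) \<partial>IT.eP t \<omega> \<partial>?C t)"
    using nn_integral_bind[OF ft eP] by simp
  also have "\<dots> = (\<integral>\<^sup>+\<omega>. \<integral>\<^sup>+x. f x \<partial>K t \<omega> \<partial>?C t)"
    by (rule nn_integral_cong) (simp add: IT.nn_integral_eP[OF _ ft] sets_eq_imp_space_eq[OF sets_C])
  also have "\<dots> = (\<integral>\<^sup>+\<omega>. \<integral>\<^sup>+x. f x \<partial>K t (restrict \<omega> {0..<t}) \<partial>X)"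
    by (rule nn_integral_trajectory_restrict[OF g])
  \<comment> \<open>\<open>K t\<close> reads at most coordinate \<open>t - 1\<close>, which the
    restriction to \<open>{0..<t}\<close> keeps.\<close>
  also have "\<dots> = (\<integral>\<^sup>+\<omega>. \<integral>\<^sup>+x. f x \<partial>K t \<omega> \<partial>X)"
    by (cases t) (simp_all add: step_kernel_def)
  finally show ?thesis .
qed

lemma step_kernel_resample:
  assumes "f \<in> borel_measurable (sa_space S)"
  shows "(\<integral>\<^sup>+x. (\<Sum>b\<in>UNIV. ennreal (\<pi> (fst x) b) * f (fst x, b)) \<partial>K t \<omega>) = (\<integral>\<^sup>+x. f x \<partial>K t \<omega>)"
  unfolding step_kernel_def using assms initial
  by (intro state_action_resample) (auto simp: space_prob_algebra split: nat.split)

lemma measurable_resample: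
  assumes [measurable]: "f \<in> borel_measurable (sa_space S)"
  shows "(\<lambda>x. \<Sum>b\<in>UNIV. ennreal (\<pi> (fst x) b) * f (fst x, b)) \<in> borel_measurable (sa_space S)"
  by measurable

section \<open>The occupancy measure as a geometric mixture of the laws at single times\<close>

abbreviation "geometric \<equiv> density (count_space UNIV) (\<lambda>t. ennreal ((1 - \<beta>) * \<beta> ^ t))"

lemma measurable_law_at_time:
  "(\<lambda>t. distr X (sa_space S) (\<lambda>\<omega>. \<omega> t)) \<in> geometric \<rightarrow>\<^sub>M subprob_algebra (sa_space S)"
  using prob_space.prob_space_distr[OF prob_space_trajectory measurable_trajectory]
  by (auto simp: measurable_def space_subprob_algebra prob_space_imp_subprob_space)

text \<open>\<open>measure_of\<close> returns the zero measure when its set function is not a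
  measure. Matching that function with the \<open>emeasure\<close> of a bind shows that it is one
  and opens \<open>occupancy\<close> to \<open>nn_integral_bind\<close>.\<close>

lemma occupancy_eq:
  "d = geometric \<bind> (\<lambda>t. distr X (sa_space S) (\<lambda>\<omega>. \<omega> t))"
    (is "_ = ?D")
proof -
  have sets_D: "sets ?D = sets (sa_space S)"
    by (rule sets_bind) (auto simp: space_density)
  have space_D: "space ?D = UNIV"
    using sets_eq_imp_space_eq[OF sets_D] by (simp add: space_pair_measure space_S)
  have "emeasure ?D A = ennreal (1 - \<beta>) *
      (\<Sum>t. ennreal (\<beta> ^ t) * emeasure X {\<omega> \<in> space X. \<omega> t \<in> A})"
    if A: "A \<in> sets (sa_space S)" for A
  proof -
    have "emeasure ?D A = (\<integral>\<^sup>+t. emeasure (distr X (sa_space S) (\<lambda>\<omega>. \<omega> t)) A \<partial>geometric)"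
      by (rule emeasure_bind[OF _ measurable_law_at_time A]) (simp add: space_density)
    also have "\<dots> = (\<Sum>t. ennreal ((1 - \<beta>) * \<beta> ^ t) * emeasure X {\<omega> \<in> space X. \<omega> t \<in> A})"
      using A
      by (subst nn_integral_density)
        (auto simp: nn_integral_count_space_nat emeasure_distr vimage_def Int_def conj_commute)
    also have "\<dots> = ennreal (1 - \<beta>) * (\<Sum>t. ennreal (\<beta> ^ t) * emeasure X {\<omega> \<in> space X. \<omega> t \<in> A})"
      using discount_pos discount_less_1
      by (simp add: ennreal_mult mult.assoc ennreal_suminf_cmult)
    finally show ?thesis .
  qed
  moreover have "?D = measure_of UNIV (sets (sa_space S)) (emeasure ?D)"
    using measure_of_of_measure[of ?D] by (simp add: sets_D space_D)
  moreover have "sets (sa_space S) \<subseteq> Pow UNIV" "sigma_sets UNIV (sets (sa_space S)) = sets (sa_space S)"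
    using sets.sigma_sets_eq[of "sa_space S"] by (simp_all add: space_pair_measure space_S)
  ultimately show ?thesis
    unfolding occupancy_def by (metis (no_types, lifting) measure_of_eq)
qed

lemma sets_occupancy [measurable_cong, simp]: "sets d = sets (sa_space S)"
  unfolding occupancy_eq by (rule sets_bind) (auto simp: space_density)

lemma nn_integral_occupancy:
  assumes [measurable]: "f \<in> borel_measurable (sa_space S)"
  shows "(\<integral>\<^sup>+x. f x \<partial>d) = (\<Sum>t. ennreal ((1 - \<beta>) * \<beta> ^ t) * (\<integral>\<^sup>+\<omega>. f (\<omega> t) \<partial>X))"
  unfolding occupancy_eq
  by (subst nn_integral_bind[OF _ measurable_law_at_time])
    (simp_all add: nn_integral_density nn_integral_count_space_nat nn_integral_distr)

lemma prob_space_occupancy: "prob_space d"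
proof (rule prob_spaceI)
  interpret X: prob_space X by (rule prob_space_trajectory)
  have "emeasure d (space d) = (\<integral>\<^sup>+x. 1 \<partial>d)" by simp
  also have "\<dots> = (\<Sum>t. ennreal ((1 - \<beta>) * \<beta> ^ t))"
    by (subst nn_integral_occupancy) (simp_all add: X.emeasure_space_1)
  also have "\<dots> = ennreal (\<Sum>t. (1 - \<beta>) * \<beta> ^ t)"
    using discount_pos discount_less_1
    by (intro suminf_ennreal2) (auto intro!: summable_mult summable_geometric)
  also have "(\<Sum>t. (1 - \<beta>) * \<beta> ^ t) = 1"
    using discount_pos discount_less_1
    by (subst suminf_mult) (auto simp: suminf_geometric summable_geometric)
  finally show "emeasure d (space d) = 1" by simp
qed

text \<open>At every time the action is drawn last, so the invariance of each \<open>K t\<close>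
  passes to the laws of the coordinates and to their mixture.\<close>

lemma occupancy_resample:
  assumes "f \<in> borel_measurable (sa_space S)"
  shows "(\<integral>\<^sup>+x. (\<Sum>b\<in>UNIV. ennreal (\<pi> (fst x) b) * f (fst x, b)) \<partial>d) = (\<integral>\<^sup>+x. f x \<partial>d)"
  unfolding nn_integral_occupancy[OF assms] nn_integral_occupancy[OF measurable_resample[OF assms]]
    nn_integral_trajectory[OF assms] nn_integral_trajectory[OF measurable_resample[OF assms]]
    step_kernel_resample[OF assms] ..

section \<open>Almost sure properties under the occupancy measure\<close>

text \<open>Each weight \<open>(1 - \<beta>) * \<beta> ^ t\<close> is positive, so a null set of the
  mixture is null at every single time.\<close>

lemma AE_occupancy_imp_trajectory:
  assumes [measurable]: "Measurable.pred (sa_space S) \<phi>" and "AE x in d. \<phi> x"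
  shows "AE \<omega> in X. \<phi> (\<omega> t)"
proof -
  let ?f = "\<lambda>x. indicator {x \<in> space (sa_space S). \<not> \<phi> x} x :: ennreal"
  have [measurable]: "?f \<in> borel_measurable (sa_space S)" by measurable
  have sp: "space (sa_space S) = UNIV" by (simp add: space_pair_measure space_S)
  have "(\<integral>\<^sup>+x. ?f x \<partial>d) = 0"
    using assms(2) by (subst nn_integral_cong_AE[where v="\<lambda>_. 0"]) (auto elim!: eventually_mono)
  then have "(\<Sum>t. ennreal ((1 - \<beta>) * \<beta> ^ t) * (\<integral>\<^sup>+\<omega>. ?f (\<omega> t) \<partial>X)) = 0"
    by (subst (asm) nn_integral_occupancy) simp_all
  then have "ennreal ((1 - \<beta>) * \<beta> ^ t) * (\<integral>\<^sup>+\<omega>. ?f (\<omega> t) \<partial>X) = 0"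
    by (subst (asm) suminf_eq_zero_iff) auto
  moreover have "0 < (1 - \<beta>) * \<beta> ^ t"
    using discount_pos discount_less_1 by simp
  ultimately have "(\<integral>\<^sup>+\<omega>. ?f (\<omega> t) \<partial>X) = 0"
    by (auto simp: ennreal_eq_0_iff)
  then show ?thesis
    by (subst (asm) nn_integral_0_iff_AE) (auto simp: sp elim!: eventually_mono split: split_indicator_asm)
qed

text \<open>The indicator of the exceptional set has integral \<open>0\<close>, hence so has its
  resampled version. There each action carries a positive weight, so a vanishing sum forces the
  indicator to vanish at every action.\<close>

lemma AE_occupancy_resample:
  assumes [measurable]: "Measurable.pred (sa_space S) \<phi>" and "AE x in d. \<phi> x"
    and pos: "\<And>s a. 0 < \<pi> s a"
  shows "AE x in d. \<forall>b. \<phi> (fst x, b)"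
proof -
  let ?f = "\<lambda>x. indicator {x \<in> space (sa_space S). \<not> \<phi> x} x :: ennreal"
  have [measurable]: "?f \<in> borel_measurable (sa_space S)" by measurable
  have sp: "space (sa_space S) = UNIV" by (simp add: space_pair_measure space_S)
  have "(\<integral>\<^sup>+x. ?f x \<partial>d) = 0"
    using assms(2) by (subst nn_integral_cong_AE[where v="\<lambda>_. 0"]) (auto elim!: eventually_mono)
  then have "(\<integral>\<^sup>+x. (\<Sum>b\<in>UNIV. ennreal (\<pi> (fst x) b) * ?f (fst x, b)) \<partial>d) = 0"
    by (subst occupancy_resample) simp_all
  moreover have "(\<lambda>x. \<Sum>b\<in>UNIV. ennreal (\<pi> (fst x) b) * ?f (fst x, b)) \<in> borel_measurable d"
    using measurable_resample[of ?f] by (simp add: measurable_cong_sets[OF sets_occupancy refl] del: sum_mult_indicator)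
  ultimately have "AE x in d. (\<Sum>b\<in>UNIV. ennreal (\<pi> (fst x) b) * ?f (fst x, b)) = 0"
    by (simp only: nn_integral_0_iff_AE)
  then show ?thesis
    by (rule eventually_mono)
      (use pos in \<open>force simp: sp sum_nonneg_eq_0_iff ennreal_eq_0_iff not_le[symmetric] split: split_indicator_asm\<close>)
qed

text \<open>The occupancy measure satisfies \<open>\<beta> d P \<le> d\<close> on state marginals, since one step
  of the chain is one shift of the time index.\<close>

lemma AE_occupancy_next:
  assumes [measurable]: "Measurable.pred S \<phi>" and AE: "AE x in d. \<phi> (fst x)"
    and pos: "\<And>s a. 0 < \<pi> s a"
  shows "AE x in d. \<forall>b. AE s' in P (fst x) b. \<phi> s'"
proof -
  let ?f = "\<lambda>s. indicator {s \<in> space S. \<not> \<phi> s} s :: ennreal"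
  let ?g = "\<lambda>x. \<integral>\<^sup>+s'. ?f s' \<partial>P (fst x) (snd x)"
  have f [measurable]: "?f \<in> borel_measurable S" by measurable
  have g [measurable]: "?g \<in> borel_measurable (sa_space S)"
    by (rule measurable_compose[OF measurable_prob_algebraD[OF transition_pair]
          nn_integral_measurable_subprob_algebra[OF f]])
  have "(\<integral>\<^sup>+\<omega>. ?g (\<omega> t) \<partial>X) = 0" for t
  proof -
    \<comment> \<open>The integrand ignores the action drawn at time \<open>Suc t\<close>, so
      summing over that action leaves the transition probability of the exceptional set.\<close>
    have "(\<integral>\<^sup>+x. ?f (fst x) \<partial>K (Suc t) \<omega>) = ?g (\<omega> t)" for \<omega>
    proof -
      have "(\<Sum>a\<in>UNIV. ennreal (\<pi> s a) * y) = y" for s y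
        by (simp add: sum_distrib_right[symmetric] sum_ennreal policy_nonneg policy_sum)
      then show ?thesis
        unfolding step_kernel_def by (subst nn_integral_state_action) simp_all
    qed
    then have "(\<integral>\<^sup>+\<omega>. ?g (\<omega> t) \<partial>X) = (\<integral>\<^sup>+\<omega>. ?f (fst (\<omega> (Suc t))) \<partial>X)"
      using nn_integral_trajectory[of "\<lambda>x. ?f (fst x)" "Suc t"] by simp
    also have "\<dots> = 0"
      using AE_occupancy_imp_trajectory[OF _ AE, of "Suc t"]
      by (subst nn_integral_0_iff_AE) (auto elim!: eventually_mono)
    finally show ?thesis .
  qed
  then have "(\<integral>\<^sup>+x. ?g x \<partial>d) = 0"
    by (simp only: nn_integral_occupancy[OF g] mult_zero_right suminf_zero)
  moreover have "?g \<in> borel_measurable d"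
    using g by (simp only: measurable_cong_sets[OF sets_occupancy refl])
  ultimately have "AE x in d. ?g x = 0"
    by (simp only: nn_integral_0_iff_AE)
  moreover have "Measurable.pred (sa_space S) (\<lambda>x. ?g x = 0)"
    using g by measurable
  \<comment> \<open>So far \<open>?g\<close> vanishes at the action actually taken; resampling
    extends this to every action.\<close>
  ultimately have "AE x in d. \<forall>b. ?g (fst x, b) = 0"
    by (intro AE_occupancy_resample pos)
  then show ?thesis
  proof (rule eventually_mono, intro allI)
    fix x b assume "\<forall>b. ?g (fst x, b) = 0"
    then have "(\<integral>\<^sup>+s'. ?f s' \<partial>P (fst x) b) = 0" by simp
    moreover have "?f \<in> borel_measurable (P (fst x) b)"
      using f by (simp cong: measurable_cong_sets)
    ultimately show "AE s' in P (fst x) b. \<phi> s'"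
      by (subst (asm) nn_integral_0_iff_AE)
        (auto simp: space_S elim!: eventually_mono split: split_indicator_asm)
  qed
qed

end

section \<open>Moments and extended expectations\<close>

lemma (in prob_space) expectation_sq_dev:
  fixes Y :: "'a \<Rightarrow> real"
  assumes Y: "integrable M Y" "integrable M (\<lambda>x. (Y x)\<^sup>2)"
  shows "expectation (\<lambda>x. (Y x - z)\<^sup>2) = variance Y + (z - expectation Y)\<^sup>2"
proof -
  have *: "expectation (\<lambda>x. (Y x - w)\<^sup>2) = expectation (\<lambda>x. (Y x)\<^sup>2) - 2 * w * expectation Y + w\<^sup>2" for w
  proof -
    have "expectation (\<lambda>x. (Y x - w)\<^sup>2) = expectation (\<lambda>x. (Y x)\<^sup>2 - 2 * w * Y x + w\<^sup>2)"
      by (simp add: power2_diff algebra_simps)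
    also have "\<dots> = expectation (\<lambda>x. (Y x)\<^sup>2) - 2 * w * expectation Y + w\<^sup>2"
      using Y by (simp add: prob_space)
    finally show ?thesis .
  qed
  show ?thesis
    unfolding *[of z] *[of "expectation Y"] by (simp add: power2_eq_square algebra_simps)
qed

text \<open>The shift by the upper bound \<open>c\<close> replaces a difference of two integrals by
  one integral of a nonnegative function, to which Tonelli and monotonicity apply even if
  \<open>f\<close> is not integrable.\<close>

lemma (in prob_space) ereal_expectation_bounded_above:
  assumes f [measurable]: "f \<in> borel_measurable M" and le: "\<And>x. f x \<le> c"
  shows "ereal_expectation M f = ereal c - enn2ereal (\<integral>\<^sup>+x. ennreal (c - f x) \<partial>M)"
proof (cases "integrable M f")
  case True
  then have fin: "(\<integral>\<^sup>+x. ennreal (f x) \<partial>M) \<noteq> \<top>" "(\<integral>\<^sup>+x. ennreal (- f x) \<partial>M) \<noteq> \<top>"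
    by (auto simp: real_integrable_def)
  have nonneg: "0 \<le> c - (\<integral>x. f x \<partial>M)"
    using integral_le_const[OF True, of c] le by simp
  have "(\<integral>\<^sup>+x. ennreal (c - f x) \<partial>M) = ennreal (\<integral>x. c - f x \<partial>M)"
    using True le by (intro nn_integral_eq_integral) auto
  also have "(\<integral>x. c - f x \<partial>M) = c - (\<integral>x. f x \<partial>M)"
    using True by (simp add: prob_space)
  finally have "ereal c - enn2ereal (\<integral>\<^sup>+x. ennreal (c - f x) \<partial>M) = ereal (\<integral>x. f x \<partial>M)"
    using nonneg by (simp add: enn2ereal_ennreal)
  moreover have "ereal_expectation M f = ereal (\<integral>x. f x \<partial>M)"
  proof -
    obtain p q where "0 \<le> p" "(\<integral>\<^sup>+x. ennreal (f x) \<partial>M) = ennreal p"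
      "0 \<le> q" "(\<integral>\<^sup>+x. ennreal (- f x) \<partial>M) = ennreal q"
      using fin by (metis ennreal_cases)
    then show ?thesis
      unfolding ereal_expectation_def real_lebesgue_integral_def[OF True]
      by (simp add: enn2ereal_ennreal)
  qed
  ultimately show ?thesis by simp
next
  \<comment> \<open>The positive part has a finite integral, so non-integrability means an infinite
    negative part, and both sides are minus infinity.\<close>
  case False
  have "(\<integral>\<^sup>+x. ennreal (f x) \<partial>M) \<le> (\<integral>\<^sup>+x. ennreal c \<partial>M)"
    using le by (intro nn_integral_mono) (simp add: ennreal_leI)
  also have "\<dots> = ennreal c" by (simp add: emeasure_space_1)
  finally have pos: "(\<integral>\<^sup>+x. ennreal (f x) \<partial>M) \<noteq> \<top>"
    by (auto simp: top_unique)
  then have neg: "(\<integral>\<^sup>+x. ennreal (- f x) \<partial>M) = \<top>"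
    using False f by (auto simp: real_integrable_def)
  have "(\<integral>\<^sup>+x. ennreal (c - f x) \<partial>M) = \<top>"
  proof (rule ccontr)
    assume "(\<integral>\<^sup>+x. ennreal (c - f x) \<partial>M) \<noteq> \<top>"
    then have "integrable M (\<lambda>x. c - f x)"
      using le by (intro integrableI_nonneg) (auto simp: top.not_eq_extremum)
    from Bochner_Integration.integrable_diff[OF integrable_const[of c] this] show False
      using False by simp
  qed
  moreover obtain p where "0 \<le> p" "(\<integral>\<^sup>+x. ennreal (f x) \<partial>M) = ennreal p"
    using pos by (metis ennreal_cases)
  ultimately show ?thesis
    unfolding ereal_expectation_def neg by (simp add: enn2ereal_ennreal)
qed

section \<open>Bounded action values\<close>

lemma Q_space_iff:
  "Q \<in> Q_space S \<longleftrightarrow> (\<forall>a. (\<lambda>s. Q s a) \<in> borel_measurable S) \<and> (\<exists>B. \<forall>s a. \<bar>Q s a\<bar> \<le> B)"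
  by (auto simp: Q_space_def bounded_iff)

lemma Q_spaceI:
  "(\<And>a. (\<lambda>s. Q s a) \<in> borel_measurable S) \<Longrightarrow> (\<And>s a. \<bar>Q s a\<bar> \<le> B) \<Longrightarrow> Q \<in> Q_space S"
  by (auto simp: Q_space_iff)

lemma Q_space_measurable: "Q \<in> Q_space S \<Longrightarrow> (\<lambda>s. Q s a) \<in> borel_measurable S"
  by (simp add: Q_space_iff)

lemma Q_space_bound:
  assumes "Q \<in> Q_space S"
  obtains B where "\<And>s a. \<bar>Q s a\<bar> \<le> B"
  using assms by (auto simp: Q_space_iff)

lemma Q_space_measurable_pair:
  fixes Q :: "'s \<Rightarrow> 'a::finite \<Rightarrow> real"
  shows "Q \<in> Q_space S \<Longrightarrow> (\<lambda>x. Q (fst x) (snd x)) \<in> borel_measurable (sa_space S)"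
  by (rule measurable_pair_count_space) (simp add: Q_space_measurable)

lemma Q_space_const: "(\<lambda>s a. c) \<in> Q_space S"
  by (rule Q_spaceI[of _ _ "\<bar>c\<bar>"]) auto

lemma Q_space_add:
  assumes "f \<in> Q_space S" "g \<in> Q_space S"
  shows "(\<lambda>s a. f s a + g s a) \<in> Q_space S"
proof -
  obtain A B where "\<And>s a. \<bar>f s a\<bar> \<le> A" "\<And>s a. \<bar>g s a\<bar> \<le> B"
    using assms by (meson Q_space_bound)
  then have "\<bar>f s a + g s a\<bar> \<le> A + B" for s a
    by (meson abs_triangle_ineq add_mono order_trans)
  moreover note [measurable] = assms[THEN Q_space_measurable]
  ultimately show ?thesis
    by (intro Q_spaceI[of _ _ "A + B"]) measurable
qed

lemma Q_space_mult:
  assumes "f \<in> Q_space S" "g \<in> Q_space S"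
  shows "(\<lambda>s a. f s a * g s a) \<in> Q_space S"
proof -
  obtain A B where AB: "\<And>s a. \<bar>f s a\<bar> \<le> A" "\<And>s a. \<bar>g s a\<bar> \<le> B"
    using assms by (meson Q_space_bound)
  have "\<bar>f s a * g s a\<bar> \<le> A * B" for s a
    unfolding abs_mult using AB[of s a] by (intro mult_mono) auto
  moreover note [measurable] = assms[THEN Q_space_measurable]
  ultimately show ?thesis
    by (intro Q_spaceI[of _ _ "A * B"]) measurable
qed

lemma Q_space_diff:
  assumes "f \<in> Q_space S" "g \<in> Q_space S"
  shows "(\<lambda>s a. f s a - g s a) \<in> Q_space S"
  using Q_space_add[OF assms(1) Q_space_mult[OF Q_space_const[of "-1"] assms(2)]] by simp

lemma Q_space_exp:
  assumes "f \<in> Q_space S"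
  shows "(\<lambda>s a. exp (f s a)) \<in> Q_space S"
proof -
  obtain B where "\<And>s a. \<bar>f s a\<bar> \<le> B"
    using assms by (meson Q_space_bound)
  then have "\<bar>exp (f s a)\<bar> \<le> exp B" for s a
    by (simp add: abs_le_iff)
  moreover note [measurable] = Q_space_measurable[OF assms]
  ultimately show ?thesis
    by (intro Q_spaceI[of _ _ "exp B"]) measurable
qed

text \<open>An algebra of bounded measurable functions, closed under \<open>exp\<close>: membership
  in \<open>Q_space\<close> settles measurability and integrability together. A function of the
  state alone enters as one that ignores its action, and squares enter as products.\<close>

lemmas Q_space_intros = Q_space_const Q_space_add Q_space_mult Q_space_diff Q_space_exp

lemma sum_exp_pos: "0 < (\<Sum>a\<in>UNIV. exp (Q s a :: real))" for Q :: "'s \<Rightarrow> 'a::finite \<Rightarrow> real"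
  by (intro sum_pos) auto

lemma soft_value_space:
  fixes Q :: "'s \<Rightarrow> 'a::finite \<Rightarrow> real"
  assumes Q: "Q \<in> Q_space S"
  shows "(\<lambda>s a. soft_value Q s) \<in> Q_space S"
proof -
  obtain B where B: "\<And>s a. \<bar>Q s a\<bar> \<le> B"
    using Q by (meson Q_space_bound)
  have [measurable]: "(\<lambda>s. Q s a) \<in> borel_measurable S" for a
    using Q by (rule Q_space_measurable)
  have "\<bar>soft_value Q s\<bar> \<le> B + ln (real CARD('a))" for s
  proof -
    have card: "1 \<le> real CARD('a)" by (simp add: Suc_leI)
    \<comment> \<open>\<open>undefined\<close> serves as some action: one summand already gives the
      lower bound.\<close>
    have "exp (- B) \<le> exp (Q s undefined)"
      using B[of s undefined] by (simp add: abs_le_iff)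
    also have "\<dots> \<le> (\<Sum>a\<in>UNIV. exp (Q s a))"
      by (rule member_le_sum) auto
    finally have "- B \<le> soft_value Q s"
      unfolding soft_value_def by (simp add: ln_ge_iff sum_exp_pos)
    moreover have "(\<Sum>a\<in>UNIV. exp (Q s a)) \<le> (\<Sum>a\<in>(UNIV :: 'a set). exp B)"
      using B by (intro sum_mono) (simp add: abs_le_iff)
    then have "soft_value Q s \<le> ln (real CARD('a) * exp B)"
      unfolding soft_value_def by (simp add: sum_exp_pos ln_le_cancel_iff)
    then have "soft_value Q s \<le> B + ln (real CARD('a))"
      using card by (simp add: ln_mult)
    ultimately show ?thesis
      using ln_ge_zero[OF card] by linarith
  qed
  then show ?thesis
    by (intro Q_spaceI) (auto simp: soft_value_def)
qed

lemma choice_prob_eq_exp: "choice_prob Q s a = exp (Q s a - soft_value Q s)"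
  by (simp add: choice_prob_def soft_value_def exp_diff sum_exp_pos)

lemma choice_prob_pos: "0 < choice_prob Q s a"
  by (simp add: choice_prob_eq_exp)

lemma ln_choice_prob: "ln (choice_prob Q s a) = Q s a - soft_value Q s"
  by (simp add: choice_prob_eq_exp)

lemma sum_choice_prob: "(\<Sum>a\<in>UNIV. choice_prob Q s a) = 1"
  using sum_exp_pos[of Q s] by (simp add: choice_prob_def sum_divide_distrib[symmetric])

section \<open>The risk and its minimizers\<close>

locale soft_mdp =
  fixes S :: "'s measure"
    and P :: "'s \<Rightarrow> 'a::finite \<Rightarrow> 's measure"
    and \<nu>\<^sub>0 :: "'s measure"
    and r :: "'s \<Rightarrow> 'a \<Rightarrow> real"
    and \<beta> :: real
    and anchor :: "'s \<Rightarrow> 'a"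
    and Qstar :: "'s \<Rightarrow> 'a \<Rightarrow> real"
  assumes space_state: "space S = UNIV"
    and kernel: "\<And>a. (\<lambda>s. P s a) \<in> S \<rightarrow>\<^sub>M prob_algebra S"
    and initial_state: "\<nu>\<^sub>0 \<in> space (prob_algebra S)"
    and beta_pos: "0 < \<beta>" and beta_less_1: "\<beta> < 1"
    and anchor_measurable: "anchor \<in> S \<rightarrow>\<^sub>M count_space UNIV"
    and Qstar_space: "Qstar \<in> Q_space S"
    and Qstar_fixed: "bellman P r \<beta> Qstar = Qstar"
begin

sublocale controlled_process S "choice_prob Qstar" P \<nu>\<^sub>0 \<beta>
proof
  have "(\<lambda>s a. choice_prob Qstar s a) \<in> Q_space S"
    unfolding choice_prob_eq_exp using Qstar_space soft_value_space by (intro Q_space_intros)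
  then show "(\<lambda>s. choice_prob Qstar s a) \<in> borel_measurable S" for a
    by (rule Q_space_measurable)
qed (use space_state kernel initial_state beta_pos beta_less_1 in
    \<open>simp_all add: sum_choice_prob choice_prob_pos less_imp_le\<close>)

lemma anchor_space: "(\<lambda>s a. of_bool (a = anchor s)) \<in> Q_space S"
proof (rule Q_spaceI[of _ _ 1])
  show "(\<lambda>s. of_bool (a = anchor s) :: real) \<in> borel_measurable S" for a
    using anchor_measurable by measurable
qed auto

lemma integrable_occupancy:
  assumes "f \<in> Q_space S"
  shows "integrable d (\<lambda>x. f (fst x) (snd x))"
proof -
  interpret prob_space d by (rule prob_space_occupancy)
  obtain B where "\<And>s a. \<bar>f s a\<bar> \<le> B"
    using assms by (meson Q_space_bound)
  then show ?thesis
    using Q_space_measurable_pair[OF assms]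
    by (intro integrable_const_bound[of _ B]) (auto simp: measurable_cong_sets[OF sets_occupancy refl])
qed

lemma integrable_transition:
  assumes "(\<lambda>s a. g s) \<in> Q_space S"
  shows "integrable (P s a) g"
proof -
  interpret prob_space "P s a" by (rule prob_space_transition)
  obtain B where "\<And>s. \<bar>g s\<bar> \<le> B"
    using assms Q_space_bound by metis
  then show ?thesis
    using Q_space_measurable[OF assms]
    by (intro integrable_const_bound[of _ B]) (auto simp: measurable_cong_sets[OF sets_transition refl])
qed

lemma expectation_transition_space:
  assumes "(\<lambda>s a. g s) \<in> Q_space S"
  shows "(\<lambda>s a. \<integral>s'. g s' \<partial>P s a) \<in> Q_space S"
proof -
  obtain B where B: "\<And>s. \<bar>g s\<bar> \<le> B"
    using assms Q_space_bound by metis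
  have "g \<in> borel_measurable S" using Q_space_measurable[OF assms] .
  moreover have "\<bar>\<integral>s'. g s' \<partial>P s a\<bar> \<le> B" for s a
  proof -
    interpret prob_space "P s a" by (rule prob_space_transition)
    have "\<bar>\<integral>s'. g s' \<partial>P s a\<bar> \<le> (\<integral>s'. \<bar>g s'\<bar> \<partial>P s a)" by (rule integral_abs_bound)
    also have "\<dots> \<le> B"
      using B integrable_transition[OF assms] by (intro integral_le_const) auto
    finally show ?thesis .
  qed
  ultimately show ?thesis
    by (intro Q_spaceI)
      (auto intro!: measurable_compose[OF measurable_prob_algebraD[OF transition]
          integral_measurable_subprob_algebra])
qed

lemma reward_eq: "r s a = Qstar s a - \<beta> * (\<integral>s'. soft_value Qstar s' \<partial>P s a)"
  using fun_cong[OF fun_cong[OF Qstar_fixed], of s a] by (simp add: bellman_def)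

text \<open>Measurability and boundedness pass from \<open>Qstar\<close> to the reward through the
  fixed-point equation.\<close>

lemma reward_space: "r \<in> Q_space S"
proof -
  have "(\<lambda>s a. Qstar s a - \<beta> * (\<integral>s'. soft_value Qstar s' \<partial>P s a)) \<in> Q_space S"
    using Qstar_space by (intro Q_space_intros expectation_transition_space soft_value_space)
  then show ?thesis by (simp add: reward_eq[symmetric])
qed

lemma bellman_space:
  assumes "Q \<in> Q_space S"
  shows "bellman P r \<beta> Q \<in> Q_space S"
proof -
  have "(\<lambda>s a. r s a + \<beta> * (\<integral>s'. soft_value Q s' \<partial>P s a)) \<in> Q_space S"
    using assms by (intro Q_space_intros reward_space expectation_transition_space soft_value_space)
  then show ?thesis by (simp add: bellman_def[abs_def])
qed

section \<open>Likelihood ratio and excess risk\<close>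

text \<open>The logarithm of \<open>choice_prob Q s a / choice_prob Qstar s a\<close>, written
  through \<open>soft_value\<close> so that the rules for \<open>Q_space\<close> apply.\<close>

definition log_ratio :: "('s \<Rightarrow> 'a \<Rightarrow> real) \<Rightarrow> 's \<Rightarrow> 'a \<Rightarrow> real" where
  "log_ratio Q s a = (Q s a - soft_value Q s) - (Qstar s a - soft_value Qstar s)"

lemma log_ratio_space: "Q \<in> Q_space S \<Longrightarrow> log_ratio Q \<in> Q_space S"
  unfolding log_ratio_def[abs_def]
  using Qstar_space by (intro Q_space_intros soft_value_space)

lemma choice_prob_mult_exp_log_ratio:
  "choice_prob Qstar s a * exp (log_ratio Q s a) = choice_prob Q s a"
  by (simp add: choice_prob_eq_exp log_ratio_def exp_add[symmetric])

text \<open>Change of measure: after resampling the action, the factor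
  \<open>choice_prob Qstar\<close> cancels the denominator of the ratio, and what remains is the
  total mass of \<open>choice_prob Q\<close> at each state.\<close>

lemma integral_exp_log_ratio:
  assumes "Q \<in> Q_space S"
  shows "(\<integral>x. exp (log_ratio Q (fst x) (snd x)) \<partial>d) = 1"
proof -
  interpret prob_space d by (rule prob_space_occupancy)
  have E: "(\<lambda>s a. exp (log_ratio Q s a)) \<in> Q_space S"
    using assms by (intro Q_space_exp log_ratio_space)
  let ?f = "\<lambda>x. ennreal (exp (log_ratio Q (fst x) (snd x)))"
  have f: "?f \<in> borel_measurable (sa_space S)"
    using Q_space_measurable_pair[OF E] by simp
  have "(\<integral>\<^sup>+x. ?f x \<partial>d) = (\<integral>\<^sup>+x. (\<Sum>b\<in>UNIV. ennreal (choice_prob Qstar (fst x) b) * ?f (fst x, b)) \<partial>d)"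
    by (rule occupancy_resample[OF f, symmetric])
  also have "\<dots> = (\<integral>\<^sup>+x. (\<Sum>b\<in>UNIV. ennreal (choice_prob Q (fst x) b)) \<partial>d)"
    by (simp add: ennreal_mult[symmetric] policy_nonneg choice_prob_mult_exp_log_ratio)
  also have "\<dots> = (\<integral>\<^sup>+x. 1 \<partial>d)"
    by (simp add: sum_ennreal choice_prob_pos less_imp_le sum_choice_prob)
  also have "\<dots> = 1" using emeasure_space_1 by simp
  finally have "ennreal (\<integral>x. exp (log_ratio Q (fst x) (snd x)) \<partial>d) = 1"
    using integrable_occupancy[OF E] by (subst nn_integral_eq_integral[symmetric]) auto
  then show ?thesis by simp
qed

text \<open>The pointwise excess loss: with \<open>u\<close> the log likelihood ratio of \<open>choice_prob Q\<close> to
  \<open>choice_prob Qstar\<close>, the Kullback-Leibler part is written as \<open>exp u - 1 - u\<close>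
  instead of \<open>- u\<close>. The two have the same integral since \<open>exp u\<close> has mean \<open>1\<close>,
  but only the former is nonnegative pointwise.\<close>

definition excess :: "('s \<Rightarrow> 'a \<Rightarrow> real) \<Rightarrow> 's \<Rightarrow> 'a \<Rightarrow> real" where
  "excess Q s a = (exp (log_ratio Q s a) - 1 - log_ratio Q s a) +
     of_bool (a = anchor s) * ((bellman P r \<beta> Q s a - Q s a) * (bellman P r \<beta> Q s a - Q s a))"

lemma excess_space: "Q \<in> Q_space S \<Longrightarrow> excess Q \<in> Q_space S"
  unfolding excess_def[abs_def]
  by (intro Q_space_intros log_ratio_space anchor_space bellman_space)

lemma excess_nonneg: "0 \<le> excess Q s a"
  using exp_ge_add_one_self[of "log_ratio Q s a"] unfolding excess_def
  by (intro add_nonneg_nonneg) (linarith, simp)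

lemma excess_eq_0D:
  assumes "excess Q s a = 0"
  shows "log_ratio Q s a = 0" and "a = anchor s \<Longrightarrow> bellman P r \<beta> Q s a = Q s a"
proof -
  have nonneg: "0 \<le> exp (log_ratio Q s a) - 1 - log_ratio Q s a"
    using exp_ge_add_one_self[of "log_ratio Q s a"] by linarith
  have "0 \<le> of_bool (a = anchor s) * ((bellman P r \<beta> Q s a - Q s a) * (bellman P r \<beta> Q s a - Q s a))"
    by simp
  with assms nonneg have eq: "exp (log_ratio Q s a) - 1 - log_ratio Q s a = 0"
    and "of_bool (a = anchor s) * ((bellman P r \<beta> Q s a - Q s a) * (bellman P r \<beta> Q s a - Q s a)) = 0"
    unfolding excess_def by linarith+
  then show "a = anchor s \<Longrightarrow> bellman P r \<beta> Q s a = Q s a" by simp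
  \<comment> \<open>With \<open>x = exp u\<close> for the log ratio \<open>u\<close>, the equation
    reads \<open>ln x = x - 1\<close>, whose only solution is \<open>x = 1\<close>.\<close>
  have "exp (log_ratio Q s a) = 1"
    using eq by (intro ln_eq_minus_one) simp_all
  then show "log_ratio Q s a = 0" by simp
qed

definition loss :: "('s \<Rightarrow> 'a \<Rightarrow> real) \<Rightarrow> 's \<Rightarrow> 'a \<Rightarrow> real" where
  "loss Q s a = - ln (choice_prob Q s a) + of_bool (a = anchor s) * (bellman P r \<beta> Q s a - Q s a)\<^sup>2"

lemma loss_space: "Q \<in> Q_space S \<Longrightarrow> loss Q \<in> Q_space S"
proof -
  assume "Q \<in> Q_space S"
  then have "(\<lambda>s a. (soft_value Q s - Q s a) + of_bool (a = anchor s) *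
      ((bellman P r \<beta> Q s a - Q s a) * (bellman P r \<beta> Q s a - Q s a))) \<in> Q_space S"
    by (intro Q_space_intros soft_value_space anchor_space bellman_space)
  then show ?thesis
    by (simp add: loss_def[abs_def] ln_choice_prob power2_eq_square)
qed

abbreviation "risk \<equiv> expected_risk P r \<beta> anchor d"

lemma risk_eq: "risk Q = (\<integral>x. loss Q (fst x) (snd x) \<partial>d)"
  by (simp add: expected_risk_def loss_def case_prod_unfold)

lemma risk_diff:
  assumes Q: "Q \<in> Q_space S"
  shows "risk Q = risk Qstar + (\<integral>x. excess Q (fst x) (snd x) \<partial>d)"
proof -
  interpret prob_space d by (rule prob_space_occupancy)
  have E: "(\<lambda>s a. exp (log_ratio Q s a)) \<in> Q_space S"
    using Q by (intro Q_space_exp log_ratio_space)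
  note [simp] = integrable_occupancy[OF loss_space[OF Qstar_space]] integrable_occupancy[OF E]
    integrable_occupancy[OF excess_space[OF Q]]
  \<comment> \<open>The Bellman residual of \<open>Qstar\<close> is zero, and the last summand has
    mean \<open>0\<close> because the likelihood ratio has mean \<open>1\<close>.\<close>
  have "loss Q s a = loss Qstar s a + excess Q s a + (1 - exp (log_ratio Q s a))" for s a
    by (simp add: loss_def excess_def ln_choice_prob Qstar_fixed log_ratio_def power2_eq_square)
  then have "risk Q = (\<integral>x. loss Qstar (fst x) (snd x) + excess Q (fst x) (snd x) +
      (1 - exp (log_ratio Q (fst x) (snd x))) \<partial>d)"
    by (simp add: risk_eq)
  also have "\<dots> = risk Qstar + (\<integral>x. excess Q (fst x) (snd x) \<partial>d)"
    using prob_space by (simp add: risk_eq integral_exp_log_ratio[OF Q])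
  finally show ?thesis .
qed

lemma risk_ge: "Q \<in> Q_space S \<Longrightarrow> risk Qstar \<le> risk Q"
  by (simp add: risk_diff integral_nonneg_AE excess_nonneg)

section \<open>Identification of the minimizer\<close>

lemma AE_identified:
  assumes Q: "Q \<in> Q_space S" and min: "risk Q \<le> risk Qstar"
  shows "AE x in d. \<forall>b. Q (fst x) b = Qstar (fst x) b"
proof -
  \<comment> \<open>Equal choice probabilities leave \<open>Q\<close> free up to a shift depending
    on the state; \<open>c\<close> is that shift.\<close>
  define c where "c s = soft_value Q s - soft_value Qstar s" for s
  have c_space: "(\<lambda>s a. c s) \<in> Q_space S"
    unfolding c_def using Q Qstar_space by (intro Q_space_intros soft_value_space)
  have [measurable]: "c \<in> borel_measurable S"
    using Q_space_measurable[OF c_space] .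
  have "(\<integral>x. excess Q (fst x) (snd x) \<partial>d) = 0"
    using risk_diff[OF Q] min by (intro antisym) (simp_all add: integral_nonneg_AE excess_nonneg)
  then have ae: "AE x in d. excess Q (fst x) (snd x) = 0"
    by (subst (asm) integral_nonneg_eq_0_iff_AE)
      (auto simp: excess_nonneg integrable_occupancy[OF excess_space[OF Q]])
  have pred: "Measurable.pred (sa_space S) (\<lambda>x. excess Q (fst x) (snd x) = 0)"
    using Q_space_measurable_pair[OF excess_space[OF Q]] by measurable
  \<comment> \<open>Zero excess is needed at the anchor action, whichever action was drawn.\<close>
  from AE_occupancy_resample[OF pred ae choice_prob_pos] have "AE x in d. \<forall>b. excess Q (fst x) b = 0"
    by simp
  then have AE_c: "AE x in d. (\<forall>b. Q (fst x) b = Qstar (fst x) b + c (fst x)) \<and>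
      c (fst x) = \<beta> * (\<integral>s'. c s' \<partial>P (fst x) (anchor (fst x)))"
  proof (rule eventually_mono, intro conjI allI)
    fix x assume *: "\<forall>b. excess Q (fst x) b = 0"
    let ?s = "fst x" let ?a = "anchor (fst x)"
    show shift: "Q ?s b = Qstar ?s b + c ?s" for b
      using excess_eq_0D(1)[OF *[rule_format, of b]] by (simp add: log_ratio_def c_def)
    \<comment> \<open>Subtracting the fixed-point equation of \<open>Qstar\<close> from this one
      cancels the reward and leaves a recursion for \<open>c\<close>.\<close>
    have "bellman P r \<beta> Q ?s ?a = Q ?s ?a"
      using excess_eq_0D(2)[OF *[rule_format, of ?a]] by simp
    moreover have "(\<integral>s'. c s' \<partial>P ?s ?a) =
        (\<integral>s'. soft_value Q s' \<partial>P ?s ?a) - (\<integral>s'. soft_value Qstar s' \<partial>P ?s ?a)"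
      unfolding c_def
      by (intro Bochner_Integration.integral_diff integrable_transition soft_value_space Q Qstar_space)
    ultimately show "c ?s = \<beta> * (\<integral>s'. c s' \<partial>P ?s ?a)"
      using shift[of ?a] reward_eq[of ?s ?a] by (simp add: bellman_def right_diff_distrib)
  qed
  obtain B where B: "\<And>s. \<bar>c s\<bar> \<le> B"
    using c_space Q_space_bound by metis
  \<comment> \<open>Contraction in the almost sure bound: by \<open>AE_occupancy_next\<close> the
    bound for \<open>n\<close> holds at successor states too, and the recursion for \<open>c\<close>
    multiplies it by \<open>\<beta>\<close>.\<close>
  have "AE x in d. \<bar>c (fst x)\<bar> \<le> \<beta> ^ n * B" for n
  proof (induction n)
    case 0
    then show ?case using B by simp
  next
    case (Suc n)
    have "AE x in d. \<forall>b. AE s' in P (fst x) b. \<bar>c s'\<bar> \<le> \<beta> ^ n * B"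
      by (rule AE_occupancy_next[OF _ Suc choice_prob_pos]) measurable
    with AE_c show ?case
    proof eventually_elim
      case (elim x)
      interpret prob_space "P (fst x) (anchor (fst x))" by (rule prob_space_transition)
      have "\<bar>\<integral>s'. c s' \<partial>P (fst x) (anchor (fst x))\<bar> \<le> (\<integral>s'. \<bar>c s'\<bar> \<partial>P (fst x) (anchor (fst x)))"
        by (rule integral_abs_bound)
      also have "\<dots> \<le> \<beta> ^ n * B"
        using elim(2) integrable_transition[OF c_space] by (intro integral_le_const) auto
      finally have "\<beta> * \<bar>\<integral>s'. c s' \<partial>P (fst x) (anchor (fst x))\<bar> \<le> \<beta> * (\<beta> ^ n * B)"
        using beta_pos by (intro mult_left_mono) auto
      moreover have "\<bar>c (fst x)\<bar> = \<beta> * \<bar>\<integral>s'. c s' \<partial>P (fst x) (anchor (fst x))\<bar>"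
        using conjunct2[OF elim(1)] beta_pos by (metis abs_mult abs_of_pos)
      ultimately show ?case by (simp add: mult.assoc)
    qed
  qed
  then have "AE x in d. \<forall>n. \<bar>c (fst x)\<bar> \<le> \<beta> ^ n * B"
    by (simp add: AE_all_countable)
  with AE_c show ?thesis
  proof eventually_elim
    case (elim x)
    have "(\<lambda>n. \<beta> ^ n * B) \<longlonglongrightarrow> 0 * B"
      using beta_pos beta_less_1 by (intro tendsto_mult LIMSEQ_realpow_zero) auto
    then have "\<bar>c (fst x)\<bar> \<le> 0"
      using elim(2) by (intro LIMSEQ_le_const[where X="\<lambda>n. \<beta> ^ n * B"]) auto
    then show ?case using elim(1) by simp
  qed
qed

text \<open>A reachable state has positive mass at some time \<open>h\<close>, and the almost sure
  agreement, transferred to time \<open>h\<close>, leaves no such mass for a state of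
  disagreement.\<close>

lemma identified:
  assumes Q: "Q \<in> Q_space S" and min: "risk Q \<le> risk Qstar"
    and s: "s \<in> reachable_states S P \<nu>\<^sub>0 (choice_prob Qstar)"
  shows "Q s a = Qstar s a"
proof (rule ccontr)
  assume neq: "Q s a \<noteq> Qstar s a"
  obtain h where h: "0 < measure X {\<omega> \<in> space X. fst (\<omega> h) = s}"
    using s by (auto simp: reachable_states_def)
  have [measurable]: "(\<lambda>s. Q s b) \<in> borel_measurable S" "(\<lambda>s. Qstar s b) \<in> borel_measurable S" for b
    using Q Qstar_space by (auto intro: Q_space_measurable)
  have "AE \<omega> in X. \<forall>b. Q (fst (\<omega> h)) b = Qstar (fst (\<omega> h)) b"
    by (rule AE_occupancy_imp_trajectory[OF _ AE_identified[OF Q min]]) measurable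
  then have "AE \<omega> in X. \<not> fst (\<omega> h) = s"
    by (rule eventually_mono) (use neq in auto)
  \<comment> \<open>This also covers a state whose singleton is not measurable: a non-measurable
    event has \<open>emeasure\<close> equal to \<open>0\<close> by convention.\<close>
  then have "emeasure X {\<omega> \<in> space X. fst (\<omega> h) = s} = 0"
    by (rule emeasure_eq_0_AE)
  with h show False by (simp add: measure_def)
qed

section \<open>Bias-variance decomposition of the sampled Bellman error\<close>

lemma value_sq_dev_eq:
  assumes "Q \<in> Q_space S"
  shows "value_sq_dev P Q s a z =
    value_sq_dev P Q s a (\<integral>s'. soft_value Q s' \<partial>P s a) + (z - (\<integral>s'. soft_value Q s' \<partial>P s a))\<^sup>2"
proof -
  interpret prob_space "P s a" by (rule prob_space_transition)
  have V: "(\<lambda>s a. soft_value Q s) \<in> Q_space S" using assms by (rule soft_value_space)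
  from Q_space_mult[OF this this] have "(\<lambda>s a. (soft_value Q s)\<^sup>2) \<in> Q_space S"
    by (simp add: power2_eq_square)
  from expectation_sq_dev[OF integrable_transition[OF V] integrable_transition[OF this]]
  show ?thesis unfolding value_sq_dev_def .
qed

text \<open>The deviation at any \<open>z\<close> exceeds that at the mean by a square, so the
  infimum is attained at the mean.\<close>

lemma D_term_eq:
  assumes "Q \<in> Q_space S"
  shows "D_term P Q s a = value_sq_dev P Q s a (\<integral>s'. soft_value Q s' \<partial>P s a)"
  unfolding D_term_def
proof (rule cInf_eq_minimum)
  show "value_sq_dev P Q s a (\<integral>s'. soft_value Q s' \<partial>P s a) \<le> y"
    if y: "y \<in> range (value_sq_dev P Q s a)" for y
  proof -
    obtain z where "y = value_sq_dev P Q s a z" using y by auto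
    then show ?thesis using value_sq_dev_eq[OF assms, of s a z] by simp
  qed
qed auto

lemma is_arg_min_value_sq_dev_iff:
  assumes "Q \<in> Q_space S"
  shows "is_arg_min (value_sq_dev P Q s a) (\<lambda>_. True) z \<longleftrightarrow> z = (\<integral>s'. soft_value Q s' \<partial>P s a)"
proof -
  define m where "m = (\<integral>s'. soft_value Q s' \<partial>P s a)"
  have eq: "value_sq_dev P Q s a y = value_sq_dev P Q s a m + (y - m)\<^sup>2" for y
    unfolding m_def by (rule value_sq_dev_eq[OF assms])
  have "value_sq_dev P Q s a z \<le> value_sq_dev P Q s a m \<longleftrightarrow> z = m"
    unfolding eq[of z] by simp
  moreover have "value_sq_dev P Q s a m \<le> value_sq_dev P Q s a y" for y
    unfolding eq[of y] by simp
  ultimately show ?thesis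
    unfolding is_arg_min_linorder m_def[symmetric] by (auto intro: order_trans)
qed

text \<open>Divided by \<open>\<beta>\<close>, the sampled residual is the deviation of the soft
  value from a constant, so its mean square splits into a squared bias, which is the Bellman part,
  and the variance.\<close>

lemma integral_sampled_bellman_sq:
  assumes "Q \<in> Q_space S"
  shows "(\<integral>s'. (sampled_bellman r \<beta> Q s a s' - Q s a)\<^sup>2 \<partial>P s a) =
    (bellman P r \<beta> Q s a - Q s a)\<^sup>2 + \<beta>\<^sup>2 * D_term P Q s a"
proof -
  \<comment> \<open>\<open>z\<close> is the next-state value that would make \<open>Q s a\<close> an
    exact backup.\<close>
  define z where "z = (Q s a - r s a) / \<beta>"
  have z: "Q s a = r s a + \<beta> * z" using beta_pos by (simp add: z_def)
  have "(sampled_bellman r \<beta> Q s a s' - Q s a)\<^sup>2 = \<beta>\<^sup>2 * (soft_value Q s' - z)\<^sup>2" for s'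
    unfolding sampled_bellman_def z by (simp add: power2_eq_square algebra_simps)
  then have "(\<integral>s'. (sampled_bellman r \<beta> Q s a s' - Q s a)\<^sup>2 \<partial>P s a) =
      (\<integral>s'. \<beta>\<^sup>2 * (soft_value Q s' - z)\<^sup>2 \<partial>P s a)"
    by simp
  also have "\<dots> = \<beta>\<^sup>2 * value_sq_dev P Q s a z"
    by (simp add: value_sq_dev_def)
  also have "\<dots> = (bellman P r \<beta> Q s a - Q s a)\<^sup>2 + \<beta>\<^sup>2 * D_term P Q s a"
    unfolding value_sq_dev_eq[OF assms, of s a z] D_term_eq[OF assms] bellman_def z
    by (simp add: power2_eq_square algebra_simps)
  finally show ?thesis .
qed

lemma corrected_risk_eq: "Q \<in> Q_space S \<Longrightarrow> corrected_risk P r \<beta> anchor d Q = risk Q"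
  by (simp add: corrected_risk_def expected_risk_def integral_sampled_bellman_sq)

section \<open>The min-max objective\<close>

lemma zeta_measurable_pair:
  fixes \<zeta> :: "'s \<Rightarrow> 'a \<Rightarrow> real"
  shows "\<zeta> \<in> zeta_space S \<Longrightarrow> (\<lambda>x. \<zeta> (fst x) (snd x)) \<in> borel_measurable (sa_space S)"
  by (rule measurable_pair_count_space) (simp add: zeta_space_def)

abbreviation "mean_value Q s a \<equiv> (\<integral>s'. soft_value Q s' \<partial>P s a)"

abbreviation "J \<equiv> minimax_objective S P r \<beta> anchor d"

text \<open>At a fixed pair \<open>(s, a)\<close> the value \<open>z\<close> of
  \<open>\<zeta>\<close> is a number, so the integrand is bounded in \<open>s'\<close>. The variance
  of the soft value occurs in both squares and cancels, which leaves the squared bias of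
  \<open>z\<close>.\<close>

lemma integral_minimax_loss:
  assumes Q: "Q \<in> Q_space S"
  defines "f s a s' z \<equiv> - ln (choice_prob Q s a) + of_bool (a = anchor s) *
    ((sampled_bellman r \<beta> Q s a s' - Q s a)\<^sup>2 - \<beta>\<^sup>2 * (soft_value Q s' - z)\<^sup>2)"
  shows "integrable (P s a) (\<lambda>s'. f s a s' z)"
    and "(\<integral>s'. f s a s' z \<partial>P s a) =
      loss Q s a - of_bool (a = anchor s) * (\<beta>\<^sup>2 * (z - mean_value Q s a)\<^sup>2)"
proof -
  interpret prob_space "P s a" by (rule prob_space_transition)
  have "(\<lambda>s' a'. (sampled_bellman r \<beta> Q s a s' - Q s a) * (sampled_bellman r \<beta> Q s a s' - Q s a)) \<in> Q_space S"
    unfolding sampled_bellman_def by (intro Q_space_intros soft_value_space Q)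
  then have [simp]: "integrable (P s a) (\<lambda>s'. (sampled_bellman r \<beta> Q s a s' - Q s a)\<^sup>2)"
    unfolding power2_eq_square by (rule integrable_transition)
  have "(\<lambda>s' a'. (soft_value Q s' - z) * (soft_value Q s' - z)) \<in> Q_space S"
    by (intro Q_space_intros soft_value_space Q)
  then have [simp]: "integrable (P s a) (\<lambda>s'. (soft_value Q s' - z)\<^sup>2)"
    unfolding power2_eq_square by (rule integrable_transition)
  show "integrable (P s a) (\<lambda>s'. f s a s' z)"
    unfolding f_def by simp
  have "(\<integral>s'. f s a s' z \<partial>P s a) = - ln (choice_prob Q s a) + of_bool (a = anchor s) *
      ((\<integral>s'. (sampled_bellman r \<beta> Q s a s' - Q s a)\<^sup>2 \<partial>P s a) - \<beta>\<^sup>2 * value_sq_dev P Q s a z)"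
    unfolding f_def value_sq_dev_def by (simp add: prob_space)
  also have "\<dots> = loss Q s a - of_bool (a = anchor s) * (\<beta>\<^sup>2 * (z - mean_value Q s a)\<^sup>2)"
    unfolding integral_sampled_bellman_sq[OF Q] value_sq_dev_eq[OF Q, of s a z] D_term_eq[OF Q] loss_def
    by (simp add: algebra_simps)
  finally show "(\<integral>s'. f s a s' z \<partial>P s a) =
      loss Q s a - of_bool (a = anchor s) * (\<beta>\<^sup>2 * (z - mean_value Q s a)\<^sup>2)" .
qed

text \<open>\<open>\<zeta>\<close> enters through a subtracted square, so the integrand is uniformly
  bounded above; subtracting it from the bound gives a nonnegative function, and Tonelli integrates
  out the next state for any measurable \<open>\<zeta>\<close>.\<close>

lemma minimax_objective_eq:
  assumes Q: "Q \<in> Q_space S" and \<zeta>: "\<zeta> \<in> zeta_space S"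
  obtains c where "\<And>s a. loss Q s a \<le> c"
    and "J Q \<zeta> = ereal c - enn2ereal (\<integral>\<^sup>+x. ennreal (c - (loss Q (fst x) (snd x) -
      of_bool (snd x = anchor (fst x)) * (\<beta>\<^sup>2 * (\<zeta> (fst x) (snd x) - mean_value Q (fst x) (snd x))\<^sup>2))) \<partial>d)"
proof -
  let ?K = "\<lambda>x. P (fst x) (snd x)"
  let ?M = "kernel_prod d S ?K"
  define f where "f s a s' = - ln (choice_prob Q s a) + of_bool (a = anchor s) *
    ((sampled_bellman r \<beta> Q s a s' - Q s a)\<^sup>2 - \<beta>\<^sup>2 * (soft_value Q s' - \<zeta> s a)\<^sup>2)" for s a s'
  define F where "F y = f (fst (fst y)) (snd (fst y)) (snd y)" for y :: "('s \<times> 'a) \<times> 's"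
  have V: "(\<lambda>s a. soft_value Q s) \<in> Q_space S" using Q by (rule soft_value_space)
  obtain A B C L where bounds: "\<And>s a. \<bar>Q s a\<bar> \<le> A" "\<And>s. \<bar>soft_value Q s\<bar> \<le> B" "\<And>s a. \<bar>r s a\<bar> \<le> C"
    and L: "\<And>s a. \<bar>loss Q s a\<bar> \<le> L"
    using Q_space_bound[OF Q] Q_space_bound[OF V] Q_space_bound[OF reward_space]
      Q_space_bound[OF loss_space[OF Q]] by metis
  \<comment> \<open>The first entry bounds the min-max integrand, the second the loss. One constant
    for both makes the result comparable with \<open>risk_eq_ereal\<close>.\<close>
  define c where "c = max (A + B + (A + B + C)\<^sup>2) L"
  have loss_le: "loss Q s a \<le> c" for s a
    using L[of s a] by (simp add: c_def)
  have f_le: "f s a s' \<le> c" for s a s'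
  proof -
    have "\<beta> * \<bar>soft_value Q s'\<bar> \<le> 1 * B"
      using bounds(2)[of s'] beta_pos beta_less_1 by (intro mult_mono) auto
    then have "\<bar>\<beta> * soft_value Q s'\<bar> \<le> B"
      using beta_pos by (simp add: abs_mult)
    then have "\<bar>sampled_bellman r \<beta> Q s a s' - Q s a\<bar> \<le> A + B + C"
      using bounds(1)[of s a] bounds(3)[of s a] by (simp add: sampled_bellman_def)
    then have "(sampled_bellman r \<beta> Q s a s' - Q s a)\<^sup>2 \<le> (A + B + C)\<^sup>2"
      by (rule power2_le_iff_abs_le[THEN iffD2, rotated]) (use bounds in force)
    then have "of_bool (a = anchor s) *
        ((sampled_bellman r \<beta> Q s a s' - Q s a)\<^sup>2 - \<beta>\<^sup>2 * (soft_value Q s' - \<zeta> s a)\<^sup>2) \<le> (A + B + C)\<^sup>2"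
      by (auto intro: order_trans[OF diff_left_mono[of 0]])
    moreover have "- ln (choice_prob Q s a) \<le> A + B"
      using bounds(1)[of s a] bounds(2)[of s] by (simp add: ln_choice_prob)
    ultimately show ?thesis by (simp add: f_def c_def)
  qed
  have d_in: "d \<in> space (prob_algebra (sa_space S))"
    by (simp add: space_prob_algebra prob_space_occupancy)
  have M: "sets ?M = sets (sa_space S \<Otimes>\<^sub>M S)" "prob_space ?M"
    using kernel_prod_in_prob_algebra[OF d_in transition_pair] by (simp_all add: space_prob_algebra)
  have F: "F \<in> borel_measurable (sa_space S \<Otimes>\<^sub>M S)"
  proof -
    have [measurable]: "(\<lambda>x. ln (choice_prob Q (fst x) (snd x))) \<in> borel_measurable (sa_space S)"
      unfolding ln_choice_prob by (intro Q_space_measurable_pair Q_space_diff Q V)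
    have [measurable]: "(\<lambda>x. of_bool (snd x = anchor (fst x)) :: real) \<in> borel_measurable (sa_space S)"
      using Q_space_measurable_pair[OF anchor_space] .
    have [measurable]: "(\<lambda>x. Q (fst x) (snd x)) \<in> borel_measurable (sa_space S)"
      "(\<lambda>x. r (fst x) (snd x)) \<in> borel_measurable (sa_space S)"
      using Q_space_measurable_pair[OF Q] Q_space_measurable_pair[OF reward_space] .
    have [measurable]: "soft_value Q \<in> borel_measurable S"
      using Q_space_measurable[OF V] .
    have [measurable]: "(\<lambda>x. \<zeta> (fst x) (snd x)) \<in> borel_measurable (sa_space S)"
      by (rule zeta_measurable_pair[OF \<zeta>])
    show ?thesis
      unfolding F_def[abs_def] f_def sampled_bellman_def by measurable
  qed
  have "J Q \<zeta> = ereal_expectation ?M F"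
    by (simp add: minimax_objective_def F_def[abs_def] f_def case_prod_unfold)
  also have "\<dots> = ereal c - enn2ereal (\<integral>\<^sup>+y. ennreal (c - F y) \<partial>?M)"
    using F f_le
    by (intro prob_space.ereal_expectation_bounded_above[OF M(2)])
      (simp_all add: measurable_cong_sets[OF M(1) refl] F_def)
  also have "(\<integral>\<^sup>+y. ennreal (c - F y) \<partial>?M) = (\<integral>\<^sup>+x. \<integral>\<^sup>+s'. ennreal (c - F (x, s')) \<partial>?K x \<partial>d)"
    using F by (intro nn_integral_kernel_prod[OF sets_occupancy transition_pair]) measurable
  also have "\<dots> = (\<integral>\<^sup>+x. ennreal (c - (loss Q (fst x) (snd x) -
      of_bool (snd x = anchor (fst x)) * (\<beta>\<^sup>2 * (\<zeta> (fst x) (snd x) - mean_value Q (fst x) (snd x))\<^sup>2))) \<partial>d)"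
  proof (rule nn_integral_cong)
    fix x :: "'s \<times> 'a"
    interpret prob_space "?K x" by (rule prob_space_transition)
    note fint = integral_minimax_loss[OF Q, of "fst x" "snd x" "\<zeta> (fst x) (snd x)", folded f_def]
    have "(\<integral>\<^sup>+s'. ennreal (c - F (x, s')) \<partial>?K x) = ennreal (\<integral>s'. c - f (fst x) (snd x) s' \<partial>?K x)"
      unfolding F_def fst_conv snd_conv using fint(1) f_le by (intro nn_integral_eq_integral) auto
    also have "(\<integral>s'. c - f (fst x) (snd x) s' \<partial>?K x) = c - (\<integral>s'. f (fst x) (snd x) s' \<partial>?K x)"
      using fint(1) by (simp add: prob_space)
    finally show "(\<integral>\<^sup>+s'. ennreal (c - F (x, s')) \<partial>?K x) = ennreal (c - (loss Q (fst x) (snd x) -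
        of_bool (snd x = anchor (fst x)) * (\<beta>\<^sup>2 * (\<zeta> (fst x) (snd x) - mean_value Q (fst x) (snd x))\<^sup>2)))"
      unfolding fint(2) .
  qed
  finally show thesis
    using that loss_le by blast
qed

text \<open>Brings the risk into the form of \<open>minimax_objective_eq\<close>, so that the two
  differ only by the squared bias inside one integral.\<close>

lemma risk_eq_ereal:
  assumes Q: "Q \<in> Q_space S" and c: "\<And>s a. loss Q s a \<le> c"
  shows "ereal c - enn2ereal (\<integral>\<^sup>+x. ennreal (c - loss Q (fst x) (snd x)) \<partial>d) = ereal (risk Q)"
proof -
  interpret prob_space d by (rule prob_space_occupancy)
  note int = integrable_occupancy[OF loss_space[OF Q]]
  have "(\<integral>\<^sup>+x. ennreal (c - loss Q (fst x) (snd x)) \<partial>d) = ennreal (\<integral>x. c - loss Q (fst x) (snd x) \<partial>d)"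
    using int c by (intro nn_integral_eq_integral) auto
  also have "(\<integral>x. c - loss Q (fst x) (snd x) \<partial>d) = c - risk Q"
    using int prob_space by (simp add: risk_eq)
  finally have *: "(\<integral>\<^sup>+x. ennreal (c - loss Q (fst x) (snd x)) \<partial>d) = ennreal (c - risk Q)" .
  have "risk Q \<le> c"
    unfolding risk_eq using c int by (intro integral_le_const) auto
  then show ?thesis
    unfolding * by (simp add: enn2ereal_ennreal)
qed

lemma minimax_objective_le:
  assumes Q: "Q \<in> Q_space S" and \<zeta>: "\<zeta> \<in> zeta_space S"
  shows "J Q \<zeta> \<le> ereal (risk Q)"
proof -
  obtain c where c: "\<And>s a. loss Q s a \<le> c"
    and J: "J Q \<zeta> = ereal c - enn2ereal (\<integral>\<^sup>+x. ennreal (c - (loss Q (fst x) (snd x) -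
      of_bool (snd x = anchor (fst x)) * (\<beta>\<^sup>2 * (\<zeta> (fst x) (snd x) - mean_value Q (fst x) (snd x))\<^sup>2))) \<partial>d)"
    using minimax_objective_eq[OF assms] by blast
  show ?thesis
    unfolding J risk_eq_ereal[OF Q c, symmetric]
    by (intro ereal_minus_mono order_refl less_eq_ennreal.rep_eq[THEN iffD1] nn_integral_mono ennreal_leI)
      simp
qed

lemma mean_value_in_zeta_space: "Q \<in> Q_space S \<Longrightarrow> mean_value Q \<in> zeta_space S"
  unfolding zeta_space_def
  by (auto intro!: Q_space_measurable expectation_transition_space soft_value_space)

lemma minimax_objective_mean_value:
  assumes Q: "Q \<in> Q_space S"
  shows "J Q (mean_value Q) = ereal (risk Q)"
proof -
  obtain c where c: "\<And>s a. loss Q s a \<le> c"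
    and J: "J Q (mean_value Q) = ereal c - enn2ereal (\<integral>\<^sup>+x. ennreal (c - (loss Q (fst x) (snd x) -
      of_bool (snd x = anchor (fst x)) * (\<beta>\<^sup>2 * (mean_value Q (fst x) (snd x) - mean_value Q (fst x) (snd x))\<^sup>2))) \<partial>d)"
    using minimax_objective_eq[OF Q mean_value_in_zeta_space[OF Q]] by blast
  show ?thesis
    unfolding J using risk_eq_ereal[OF Q c] by simp
qed

lemma SUP_minimax_objective:
  assumes Q: "Q \<in> Q_space S"
  shows "(\<Squnion>\<zeta>\<in>zeta_space S. J Q \<zeta>) = ereal (risk Q)"
proof (rule antisym)
  show "(\<Squnion>\<zeta>\<in>zeta_space S. J Q \<zeta>) \<le> ereal (risk Q)"
    by (intro SUP_least minimax_objective_le Q)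
  show "ereal (risk Q) \<le> (\<Squnion>\<zeta>\<in>zeta_space S. J Q \<zeta>)"
    unfolding minimax_objective_mean_value[OF Q, symmetric]
    by (intro SUP_upper mean_value_in_zeta_space Q)
qed

end

theorem theorem5:
  fixes S :: "'s measure"
    and P :: "'s \<Rightarrow> 'a::finite \<Rightarrow> 's measure"
    and \<nu>\<^sub>0 :: "'s measure"
    and r :: "'s \<Rightarrow> 'a \<Rightarrow> real"
    and \<beta> :: real
    and anchor :: "'s \<Rightarrow> 'a"
    and Qstar :: "'s \<Rightarrow> 'a \<Rightarrow> real"
  assumes "space S = UNIV"
    and "\<And>a. (\<lambda>s. P s a) \<in> S \<rightarrow>\<^sub>M prob_algebra S"
    and "\<nu>\<^sub>0 \<in> space (prob_algebra S)"
    and "0 < \<beta>" and "\<beta> < 1"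
    and "anchor \<in> S \<rightarrow>\<^sub>M count_space UNIV"
    and "is_unique_fixed_point S P r \<beta> Qstar"
  shows
    "let \<pi> = choice_prob Qstar;
         d = occupancy S P \<nu>\<^sub>0 \<beta> \<pi>;
         R1 = expected_risk P r \<beta> anchor d;
         R2 = corrected_risk P r \<beta> anchor d;
         J = minimax_objective S P r \<beta> anchor d;
         R3 = (\<lambda>Q. \<Squnion>\<zeta>\<in>zeta_space S. J Q \<zeta>)
     in
       is_arg_min R1 (\<lambda>Q. Q \<in> Q_space S) Qstar \<and>
       is_arg_min R2 (\<lambda>Q. Q \<in> Q_space S) Qstar \<and>
       is_arg_min R3 (\<lambda>Q. Q \<in> Q_space S) Qstar \<and>
       (\<forall>Q\<in>Q_space S. \<exists>\<zeta>\<in>zeta_space S. J Q \<zeta> = R3 Q) \<and>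
       (\<Sqinter>Q\<in>Q_space S. R1 Q) = (\<Sqinter>Q\<in>Q_space S. R2 Q) \<and>
       ereal (\<Sqinter>Q\<in>Q_space S. R2 Q) = (\<Sqinter>Q\<in>Q_space S. R3 Q) \<and>
       (\<forall>Q. is_arg_min R1 (\<lambda>Q. Q \<in> Q_space S) Q \<or>
            is_arg_min R2 (\<lambda>Q. Q \<in> Q_space S) Q \<or>
            is_arg_min R3 (\<lambda>Q. Q \<in> Q_space S) Q \<longrightarrow>
            (\<forall>s\<in>reachable_states S P \<nu>\<^sub>0 \<pi>. \<forall>a. Q s a = Qstar s a)) \<and>
       (\<forall>s a. \<exists>zs. (\<forall>z. is_arg_min (value_sq_dev P Qstar s a) (\<lambda>_. True) z \<longleftrightarrow> z = zs) \<and>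
                   r s a = Qstar s a - \<beta> * zs)"
proof -
  interpret soft_mdp S P \<nu>\<^sub>0 r \<beta> anchor Qstar
    using assms by unfold_locales (simp_all add: is_unique_fixed_point_def)
  note Q = Qstar_space
  have min1: "is_arg_min risk (\<lambda>Q. Q \<in> Q_space S) Q' \<longleftrightarrow> Q' \<in> Q_space S \<and> risk Q' \<le> risk Qstar" for Q'
    using risk_ge Q by (auto simp: is_arg_min_linorder intro: order_trans)
  \<comment> \<open>\<open>corrected_risk\<close> and the supremum agree with the risk on
    \<open>Q_space\<close>, and the minimizers there depend only on those values.\<close>
  have min2: "is_arg_min (corrected_risk P r \<beta> anchor d) (\<lambda>Q. Q \<in> Q_space S) Q' \<longleftrightarrow>
      is_arg_min risk (\<lambda>Q. Q \<in> Q_space S) Q'" for Q'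
    by (auto simp: is_arg_min_def corrected_risk_eq)
  have min3: "is_arg_min (\<lambda>Q. \<Squnion>\<zeta>\<in>zeta_space S. J Q \<zeta>) (\<lambda>Q. Q \<in> Q_space S) Q' \<longleftrightarrow>
      is_arg_min risk (\<lambda>Q. Q \<in> Q_space S) Q'" for Q'
    by (auto simp: is_arg_min_def SUP_minimax_objective)
  \<comment> \<open>A real infimum is informative only for a set bounded below; \<open>Qstar\<close>
    as a minimum fixes its value.\<close>
  have inf1: "(\<Sqinter>Q\<in>Q_space S. risk Q) = risk Qstar"
    using Q risk_ge by (intro cInf_eq_minimum) auto
  have inf2: "(\<Sqinter>Q\<in>Q_space S. corrected_risk P r \<beta> anchor d Q) = risk Qstar"
    using inf1 by (simp add: corrected_risk_eq cong: INF_cong)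
  have inf3: "(\<Sqinter>Q\<in>Q_space S. \<Squnion>\<zeta>\<in>zeta_space S. J Q \<zeta>) = ereal (risk Qstar)"
    using Q risk_ge by (intro cInf_eq_minimum) (auto simp: SUP_minimax_objective image_iff)
  \<comment> \<open>The conditional mean of the soft value is a witness, so the inner supremum is a
    maximum.\<close>
  have attained: "\<exists>\<zeta>\<in>zeta_space S. J Q' \<zeta> = (\<Squnion>\<zeta>\<in>zeta_space S. J Q' \<zeta>)" if "Q' \<in> Q_space S" for Q'
    using that mean_value_in_zeta_space minimax_objective_mean_value SUP_minimax_objective by metis
  \<comment> \<open>The least-squares minimizer is the conditional mean, the very integral that
    appears in the fixed-point equation.\<close>
  have reward: "\<exists>zs. (\<forall>z. is_arg_min (value_sq_dev P Qstar s a) (\<lambda>_. True) z \<longleftrightarrow> z = zs) \<and>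
      r s a = Qstar s a - \<beta> * zs" for s a
    using is_arg_min_value_sq_dev_iff[OF Q, of s a] reward_eq[of s a] by blast
  show ?thesis
    unfolding Let_def min2 min3 inf1 inf2 inf3 min1
    using Q attained reward identified by blast
qed

end
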